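(* For a given connected subcubic bipartite graph $G$, one can find in polynomial time a uniquely restricted matching of $G$ of size at least $\frac{5}{9}\nu_{ur}(G)$.
   Context: All graphs are finite, simple, and undirected. A graph is subcubic if its maximum degree is at most $3$. A matching in a graph $G$ is a set of pairwise non-adjacent edges of $G$; for a matching $M$, $V(M)$ denotes the set of vertices incident with an edge in $M$. A matching $M$ in $G$ is uniquely restricted if there is no matching $M'$ in $G$ with $M'\neq M$ and $V(M')=V(M)$. The uniquely restricted matching number $\nu_{ur}(G)$ is the maximum size of a uniquely restricted matching in $G$. "Polynomial time" means time polynomial in the number $n(G)$ of vertices of the input graph $G$. *)

theory Defs
  imports Complex_Main "HOL-Computational_Algebra.Polynomial"
begin

section \<open>Graphs and uniquely restricted matchings\<close>

definition simple_graph :: "'a set \<Rightarrow> 'a set set \<Rightarrow> bool" where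
  "simple_graph V E \<longleftrightarrow> finite V \<and> (\<forall>e\<in>E. e \<subseteq> V \<and> card e = 2)"

definition degree_of :: "'a set set \<Rightarrow> 'a \<Rightarrow> nat" where
  "degree_of E v = card {e \<in> E. v \<in> e}"

definition subcubic :: "'a set \<Rightarrow> 'a set set \<Rightarrow> bool" where
  "subcubic V E \<longleftrightarrow> (\<forall>v\<in>V. degree_of E v \<le> 3)"

definition bipartite :: "'a set \<Rightarrow> 'a set set \<Rightarrow> bool" where
  "bipartite V E \<longleftrightarrow>
     (\<exists>A B. A \<union> B = V \<and> A \<inter> B = {} \<and> (\<forall>e\<in>E. \<exists>a\<in>A. \<exists>b\<in>B. e = {a, b}))"

definition connected_graph :: "'a set \<Rightarrow> 'a set set \<Rightarrow> bool" where
  "connected_graph V E \<longleftrightarrow> (\<forall>u\<in>V. \<forall>v\<in>V. (u, v) \<in> {(x, y). {x, y} \<in> E}\<^sup>*)"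

definition matching :: "'a set set \<Rightarrow> 'a set set \<Rightarrow> bool" where
  "matching E M \<longleftrightarrow> M \<subseteq> E \<and> pairwise disjnt M"

text \<open>The set of vertices covered by a matching \<open>M\<close> is \<open>\<Union>M\<close>.\<close>

definition uniquely_restricted :: "'a set set \<Rightarrow> 'a set set \<Rightarrow> bool" where
  "uniquely_restricted E M \<longleftrightarrow>
     matching E M \<and> \<not> (\<exists>M'. matching E M' \<and> M' \<noteq> M \<and> \<Union>M' = \<Union>M)"

definition nu_ur :: "'a set set \<Rightarrow> nat" where
  "nu_ur E = Max (card ` {M. uniquely_restricted E M})"


section \<open>A model of computation with running time\<close>

text \<open>
  Algorithms are programs of a deterministic first-order Lisp. Values are S-expressions over
  natural numbers. A program is a list of bodies of mutually recursive unary functions; function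
  \<open>0\<close> is the entry point. Variables are de Bruijn indices into the environment. The running
  time is the number of evaluation steps.

  A step is a constant number of pointer operations together with at most one addition,
  subtraction or zero test of numbers (values are never copied or compared as a whole, so
  substructures may be shared). As there is no multiplication, numbers grow by at most one bit per
  step. Hence the model is polynomially equivalent to Turing machines.
\<close>

datatype val = Atom nat | Dot val val

datatype unop = Car | Cdr | IsDot

datatype binop = Kons | Add | Sub

datatype exp =
    Var nat
  | Const nat
  | Op1 unop exp
  | Op2 binop exp exp
  | Cond exp exp exp
  | Bind exp exp
  | Call nat exp

type_synonym program = "exp list"

text \<open>Primitive operations are total; ill-typed applications yield the default \<open>Atom 0\<close>.\<close>

fun apply1 :: "unop \<Rightarrow> val \<Rightarrow> val" where
  "apply1 Car (Dot a b) = a"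
| "apply1 Cdr (Dot a b) = b"
| "apply1 IsDot (Dot a b) = Atom 1"
| "apply1 _ (Atom k) = Atom 0"

fun apply2 :: "binop \<Rightarrow> val \<Rightarrow> val \<Rightarrow> val" where
  "apply2 Kons a b = Dot a b"
| "apply2 Add (Atom k) (Atom l) = Atom (k + l)"
| "apply2 Sub (Atom k) (Atom l) = Atom (k - l)"
| "apply2 _ _ _ = Atom 0"

text \<open>\<open>eval P env e v t\<close>: in program \<open>P\<close> and environment \<open>env\<close>, the expression \<open>e\<close> evaluates
  to \<open>v\<close> in exactly \<open>t\<close> steps. Out-of-range variables and calls have no value.\<close>

inductive eval :: "program \<Rightarrow> val list \<Rightarrow> exp \<Rightarrow> val \<Rightarrow> nat \<Rightarrow> bool" for P where
  Var: "i < length env \<Longrightarrow> eval P env (Var i) (env ! i) 1"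
| Const: "eval P env (Const k) (Atom k) 1"
| Op1: "eval P env e v t \<Longrightarrow> eval P env (Op1 f e) (apply1 f v) (t + 1)"
| Op2: "eval P env e1 v1 t1 \<Longrightarrow> eval P env e2 v2 t2 \<Longrightarrow>
    eval P env (Op2 f e1 e2) (apply2 f v1 v2) (t1 + t2 + 1)"
| Cond_true: "eval P env c v t1 \<Longrightarrow> v \<noteq> Atom 0 \<Longrightarrow> eval P env e1 w t2 \<Longrightarrow>
    eval P env (Cond c e1 e2) w (t1 + t2 + 1)"
| Cond_false: "eval P env c (Atom 0) t1 \<Longrightarrow> eval P env e2 w t2 \<Longrightarrow>
    eval P env (Cond c e1 e2) w (t1 + t2 + 1)"
| Bind: "eval P env e1 v t1 \<Longrightarrow> eval P (v # env) e2 w t2 \<Longrightarrow>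
    eval P env (Bind e1 e2) w (t1 + t2 + 1)"
| Call: "eval P env e v t1 \<Longrightarrow> f < length P \<Longrightarrow> eval P [v] (P ! f) w t2 \<Longrightarrow>
    eval P env (Call f e) w (t1 + t2 + 1)"

inductive_cases eval_cases:
  "eval P env (Var i) v t"
  "eval P env (Const k) v t"
  "eval P env (Op1 f e) v t"
  "eval P env (Op2 f e1 e2) v t"
  "eval P env (Cond c e1 e2) v t"
  "eval P env (Bind e1 e2) v t"
  "eval P env (Call f e) v t"

lemma eval_deterministic:
  "eval P env e v t \<Longrightarrow> eval P env e v' t' \<Longrightarrow> v' = v \<and> t' = t"
proof (induction arbitrary: v' t' rule: eval.induct)
  case Var then show ?case by (auto elim: eval_cases)
next
  case Const then show ?case by (auto elim: eval_cases)
next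
  case Op1 from Op1.prems show ?case by (rule eval_cases) (auto dest: Op1.IH)
next
  case Op2 from Op2.prems show ?case by (rule eval_cases) (auto dest: Op2.IH)
next
  case Cond_true
  from Cond_true.prems show ?case
    by (rule eval_cases) (use Cond_true.hyps in \<open>auto dest: Cond_true.IH\<close>)
next
  case Cond_false
  from Cond_false.prems show ?case by (rule eval_cases) (auto dest: Cond_false.IH)
next
  case Bind from Bind.prems show ?case by (rule eval_cases) (use Bind.IH in fastforce)
next
  case Call from Call.prems show ?case by (rule eval_cases) (use Call.IH in fastforce)
qed

definition runs :: "program \<Rightarrow> val \<Rightarrow> val \<Rightarrow> nat \<Rightarrow> bool" where
  "runs P x y t \<longleftrightarrow> eval P [x] (Call 0 (Var 0)) y t"


section \<open>Input and output\<close>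

fun val_of_list :: "val list \<Rightarrow> val" where
  "val_of_list [] = Atom 0"
| "val_of_list (v # vs) = Dot v (val_of_list vs)"

definition val_of_pair :: "nat \<times> nat \<Rightarrow> val" where
  "val_of_pair uv = Dot (Atom (fst uv)) (Atom (snd uv))"

text \<open>A set of edges is presented as a list of pairs of end vertices, without repetitions, in any
  order and with either orientation of each edge.\<close>

definition encodes_edges :: "nat set set \<Rightarrow> val \<Rightarrow> bool" where
  "encodes_edges F x \<longleftrightarrow>
     (\<exists>ps. x = val_of_list (map val_of_pair ps) \<and>
       distinct (map (\<lambda>(u, v). {u, v}) ps) \<and> F = set (map (\<lambda>(u, v). {u, v}) ps))"

text \<open>The graph with vertex set \<open>{..<n}\<close> and edge set \<open>E\<close>.\<close>

definition encodes_graph :: "nat \<Rightarrow> nat set set \<Rightarrow> val \<Rightarrow> bool" where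
  "encodes_graph n E x \<longleftrightarrow> (\<exists>y. x = Dot (Atom n) y \<and> encodes_edges E y)"

end

theory Submission
  imports Defs
begin

text \<open>
  Why a ratio of $5/9$ is attainable. Let \<open>x\<close> be a vertex of a bipartite graph and \<open>b\<close> a
  neighbour of \<open>x\<close>. If all neighbours of \<open>x\<close> are deleted and \<open>M\<close> is uniquely restricted in what
  remains, then \<open>M\<close> together with the edge \<open>{x, b}\<close> is uniquely restricted in the whole graph,
  because \<open>x\<close> has no other possible partner (\<open>uniquely_restricted_select\<close>). Selecting vertices one
  after the other thus always yields a uniquely restricted matching, and the question is how much is
  lost with each selection. Two upper bounds on the optimum are available. On the one hand, the
  number \<open>nu_ur\<close> drops by at most the number of deleted vertices. On the other hand, two
  vertices with the same neighbourhood (twins) are never both covered by a uniquely restricted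
  matching, so \<open>2 * nu_ur E\<close> is at most the number of distinct non-empty neighbourhoods
  (\<open>twice_nu_ur_le\<close>). The potential \<open>3 * nu_ur E + card (nbhds E)\<close> mixes the two: it is at least
  \<open>5 * nu_ur E\<close>, and it is \<open>0\<close> for the graph without edges. Hence it suffices to reach that graph by
  selections in such a way that \<open>k\<close> selections lower the potential by at most \<open>9 * k\<close>.

  In a subcubic graph such selections exist as long as some vertex does not have degree \<open>3\<close>:

    \<^item> A pendant vertex is selected at once: this removes one neighbour and touches few others.
    \<^item> One of two twins can be deleted for free.
    \<^item> If \<open>s\<close> has degree \<open>2\<close> and its neighbours are also neighbours of a vertex \<open>p\<close> of degree \<open>3\<close>, or
      if \<open>s\<close> and \<open>p\<close> have degree \<open>2\<close> and a common neighbour, then \<open>s\<close> and \<open>p\<close> are selected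
      (\<open>potential_nested\<close>, \<open>potential_two_paths\<close>).
    \<^item> Otherwise the neighbourhoods form an antichain, and a vertex \<open>s\<close> of degree \<open>2\<close> is selected. If
      this creates no twins, the price is right (\<open>potential_twin_free\<close>). If it creates twins, they
      lie on a cycle of length four whose other two vertices are selected as well; the three
      selections together are cheap enough (\<open>potential_square\<close>).

  If every vertex of a non-empty subgraph of a connected subcubic graph has degree \<open>3\<close> in this
  subgraph, then the subgraph is the whole graph, so only a cubic input graph can block the procedure.
  A cubic bipartite graph has no perfect uniquely restricted matching, since any perfect matching
  has an alternating cycle. Therefore some vertex can be deleted from it without lowering \<open>nu_ur\<close>, and
  it is enough to run the procedure once for every deleted vertex (and once for the graph itself) and
  to keep the largest matching.

  Every step only searches all pairs of vertices for a local pattern, so the procedure is easily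
  written as a program. Its running time is bounded function by function, by computing weakest
  preconditions of the expressions with respect to result and number of steps.
\<close>

section \<open>Neighbourhoods and deletion of vertices\<close>

definition nbr :: "'a set set \<Rightarrow> 'a \<Rightarrow> 'a set" where
  "nbr E x = {y. {x, y} \<in> E}"

definition delete :: "'a set \<Rightarrow> 'a set set \<Rightarrow> 'a set set" where
  "delete X E = {e \<in> E. e \<inter> X = {}}"

text \<open>Selecting \<open>x\<close> stands for putting an edge from \<open>x\<close> to some neighbour into the matching. All
  neighbours of \<open>x\<close> are deleted, so that \<open>x\<close> itself becomes isolated and need not be mentioned.\<close>

definition select :: "'a \<Rightarrow> 'a set set \<Rightarrow> 'a set set" where
  "select x E = delete (nbr E x) E"

definition nbhds :: "'a set set \<Rightarrow> 'a set set" where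
  "nbhds E = nbr E ` \<Union>E"

text \<open>Graphs are given by their edges alone: isolated vertices are irrelevant for matchings, and
  so the vertices left over by a deletion need no bookkeeping. The vertex set is \<open>\<Union>E\<close>.\<close>

definition subcubic_bipartite :: "'a set set \<Rightarrow> bool" where
  "subcubic_bipartite E \<longleftrightarrow> finite E \<and> (\<exists>A. \<forall>e\<in>E. \<exists>a\<in>A. \<exists>b. b \<notin> A \<and> e = {a, b}) \<and> (\<forall>x. card (nbr E x) \<le> 3)"

lemma in_nbr: "y \<in> nbr E x \<longleftrightarrow> {x, y} \<in> E"
  by (simp add: nbr_def)

lemma nbr_sym: "y \<in> nbr E x \<longleftrightarrow> x \<in> nbr E y"
  by (simp add: nbr_def insert_commute)

lemma nbr_symD: "y \<in> nbr E x \<Longrightarrow> x \<in> nbr E y"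
  by (simp add: nbr_sym)

lemma delete_subset: "delete X E \<subseteq> E"
  by (auto simp: delete_def)

lemma select_subset: "select x E \<subseteq> E"
  by (auto simp: select_def delete_def)

lemma nbr_delete: "nbr (delete X E) y = (if y \<in> X then {} else nbr E y - X)"
  by (auto simp: delete_def nbr_def)

lemma delete_delete: "delete X (delete Y E) = delete (X \<union> Y) E"
  by (auto simp: delete_def)

lemma subcubic_bipartite_finite: "subcubic_bipartite E \<Longrightarrow> finite E"
  by (simp add: subcubic_bipartite_def)

lemma subcubic_bipartite_edge:
  assumes "subcubic_bipartite E" "e \<in> E"
  obtains a b where "e = {a, b}" "a \<noteq> b"
  using assms unfolding subcubic_bipartite_def by metis

lemma subcubic_bipartite_card2: "subcubic_bipartite E \<Longrightarrow> e \<in> E \<Longrightarrow> card e = 2"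
  by (metis card_2_iff subcubic_bipartite_edge)

lemma subcubic_bipartite_finite_vertices: "subcubic_bipartite E \<Longrightarrow> finite (\<Union>E)"
  by (metis card.infinite finite_Union subcubic_bipartite_card2 subcubic_bipartite_finite zero_neq_numeral)

lemma nbr_subset_vertices: "nbr E x \<subseteq> \<Union>E"
  by (auto simp: nbr_def)

lemma subcubic_bipartite_finite_nbr: "subcubic_bipartite E \<Longrightarrow> finite (nbr E x)"
  by (meson finite_subset nbr_subset_vertices subcubic_bipartite_finite_vertices)

lemma subcubic_bipartite_card_nbr: "subcubic_bipartite E \<Longrightarrow> card (nbr E x) \<le> 3"
  by (simp add: subcubic_bipartite_def)

lemma subcubic_bipartite_subset:
  assumes "subcubic_bipartite E" "E' \<subseteq> E" shows "subcubic_bipartite E'"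
proof -
  have "card (nbr E' x) \<le> 3" for x
  proof -
    have "nbr E' x \<subseteq> nbr E x" using assms(2) by (auto simp: nbr_def)
    then show ?thesis
      using card_mono[OF subcubic_bipartite_finite_nbr[OF assms(1)]] subcubic_bipartite_card_nbr[OF assms(1), of x] le_trans by blast
  qed
  moreover have "finite E'" using assms by (meson finite_subset subcubic_bipartite_finite)
  moreover have "\<exists>A. \<forall>e\<in>E'. \<exists>a\<in>A. \<exists>b. b \<notin> A \<and> e = {a, b}"
    using assms unfolding subcubic_bipartite_def by (meson subsetD)
  ultimately show ?thesis by (simp add: subcubic_bipartite_def)
qed

lemma subcubic_bipartite_coloring:
  assumes "subcubic_bipartite E"
  obtains A where "\<And>x y. y \<in> nbr E x \<Longrightarrow> x \<in> A \<longleftrightarrow> y \<notin> A"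
proof -
  obtain A where A: "\<forall>e\<in>E. \<exists>a\<in>A. \<exists>b. b \<notin> A \<and> e = {a, b}"
    using assms unfolding subcubic_bipartite_def by blast
  have "x \<in> A \<longleftrightarrow> y \<notin> A" if "y \<in> nbr E x" for x y
    using A that unfolding nbr_def by (fastforce simp: doubleton_eq_iff)
  then show ?thesis using that by blast
qed

lemma nbr_irrefl: "subcubic_bipartite E \<Longrightarrow> x \<notin> nbr E x"
  by (metis subcubic_bipartite_coloring)

lemma edge_at:
  assumes "subcubic_bipartite E" "e \<in> E" "x \<in> e"
  obtains y where "e = {x, y}" "y \<noteq> x" "y \<in> nbr E x"
proof -
  obtain a b where ab: "e = {a, b}" "a \<noteq> b" using subcubic_bipartite_edge assms(1,2) by metis
  then consider "x = a" | "x = b" using assms(3) by blast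
  then show ?thesis
  proof cases
    case 1 then show ?thesis using that[of b] ab assms(2) by (simp add: nbr_def)
  next
    case 2 then show ?thesis using that[of a] ab assms(2) by (simp add: nbr_def insert_commute)
  qed
qed

lemma in_vertices_iff: "subcubic_bipartite E \<Longrightarrow> x \<in> \<Union>E \<longleftrightarrow> nbr E x \<noteq> {}"
proof
  assume "subcubic_bipartite E" "x \<in> \<Union>E"
  then obtain e where e: "e \<in> E" "x \<in> e" by blast
  then show "nbr E x \<noteq> {}" using edge_at[OF \<open>subcubic_bipartite E\<close> e] by blast
next
  assume "nbr E x \<noteq> {}"
  then show "x \<in> \<Union>E" by (auto simp: nbr_def)
qed

lemma nbr_mono: "E' \<subseteq> E \<Longrightarrow> nbr E' x \<subseteq> nbr E x"
  by (auto simp: nbr_def)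


section \<open>Uniquely restricted matchings\<close>

lemma uniquely_restricted_matching: "uniquely_restricted E M \<Longrightarrow> matching E M"
  by (simp add: uniquely_restricted_def)

lemma uniquely_restrictedD:
  "uniquely_restricted E M \<Longrightarrow> matching E M' \<Longrightarrow> \<Union>M' = \<Union>M \<Longrightarrow> M' = M"
  by (auto simp: uniquely_restricted_def)

lemma uniquely_restrictedI:
  "matching E M \<Longrightarrow> (\<And>M'. matching E M' \<Longrightarrow> \<Union>M' = \<Union>M \<Longrightarrow> M' = M) \<Longrightarrow> uniquely_restricted E M"
  by (auto simp: uniquely_restricted_def)

lemma matching_edge_eq:
  "matching E M \<Longrightarrow> e \<in> M \<Longrightarrow> f \<in> M \<Longrightarrow> x \<in> e \<Longrightarrow> x \<in> f \<Longrightarrow> e = f"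
  by (auto simp: matching_def pairwise_def disjnt_def)

lemma uniquely_restricted_empty: "subcubic_bipartite E \<Longrightarrow> uniquely_restricted E {}"
proof (rule uniquely_restrictedI)
  fix M' assume "subcubic_bipartite E" "matching E M'" "\<Union>M' = \<Union>{}"
  then have "e = {}" "card e = 2" if "e \<in> M'" for e
    using that subcubic_bipartite_card2[OF \<open>subcubic_bipartite E\<close>] by (auto simp: matching_def)
  then show "M' = {}" by fastforce
qed (simp add: matching_def)

lemma finite_uniquely_restricted: "finite E \<Longrightarrow> finite {M. uniquely_restricted E M}"
  by (rule finite_subset[of _ "Pow E"]) (auto simp: uniquely_restricted_def matching_def)

lemma card_le_nu_ur: "finite E \<Longrightarrow> uniquely_restricted E M \<Longrightarrow> card M \<le> nu_ur E"
  unfolding nu_ur_def by (rule Max_ge) (auto intro: finite_uniquely_restricted)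

lemma nu_ur_attained:
  assumes "subcubic_bipartite E" obtains M where "uniquely_restricted E M" "card M = nu_ur E"
proof -
  have "nu_ur E \<in> card ` {M. uniquely_restricted E M}"
    unfolding nu_ur_def using assms uniquely_restricted_empty[OF assms]
    by (intro Max_in) (auto intro: finite_uniquely_restricted subcubic_bipartite_finite)
  then show ?thesis using that by auto
qed

lemma nu_ur_empty: "nu_ur {} = 0"
proof -
  have *: "{M. uniquely_restricted {} M} = {{}}"
    by (auto simp: uniquely_restricted_def matching_def)
  show ?thesis unfolding nu_ur_def * by simp
qed

text \<open>A rival of the part of \<open>M\<close> inside \<open>E'\<close> is completed by the remaining edges of \<open>M\<close> to a rival of
  \<open>M\<close>.\<close>

lemma uniquely_restricted_restrict:
  assumes "uniquely_restricted E M" "E' \<subseteq> E"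
  shows "uniquely_restricted E' (M \<inter> E')"
proof (rule uniquely_restrictedI)
  have m: "matching E M" using assms(1) by (rule uniquely_restricted_matching)
  then show "matching E' (M \<inter> E')"
    by (auto simp: matching_def pairwise_def)
  fix M' assume M': "matching E' M'" "\<Union>M' = \<Union>(M \<inter> E')"
  have "matching E (M' \<union> (M - E'))"
    unfolding matching_def
  proof (intro conjI pairwiseI)
    show "M' \<union> (M - E') \<subseteq> E" using m M'(1) assms(2) by (auto simp: matching_def)
    fix e f assume ef: "e \<in> M' \<union> (M - E')" "f \<in> M' \<union> (M - E')" "e \<noteq> f"
    have mixed: "disjnt g h" if "g \<in> M'" "h \<in> M - E'" for g h
    proof -
      have "x \<notin> h" if "x \<in> g" for x
      proof
        assume "x \<in> h"
        have "x \<in> \<Union>(M \<inter> E')" unfolding M'(2)[symmetric] using that \<open>g \<in> M'\<close> by blast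
        then obtain k where "k \<in> M \<inter> E'" "x \<in> k" by blast
        then show False using matching_edge_eq[OF m, of k h x] \<open>h \<in> M - E'\<close> \<open>x \<in> h\<close> by blast
      qed
      then show ?thesis by (auto simp: disjnt_def)
    qed
    show "disjnt e f"
      using ef mixed m M'(1) disjnt_sym by (auto simp: matching_def pairwise_def)
  qed
  moreover have "\<Union>(M' \<union> (M - E')) = \<Union>M"
    unfolding Union_Un_distrib M'(2) by blast
  ultimately have "M' \<union> (M - E') = M" using uniquely_restrictedD[OF assms(1)] by blast
  moreover have "M' \<subseteq> E'" using M'(1) by (auto simp: matching_def)
  ultimately show "M' = M \<inter> E'" by blast
qed

text \<open>The edges of an optimal matching outside \<open>E'\<close> are disjoint, hence use different elements of the
  cover \<open>C\<close>.\<close>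

lemma nu_ur_le_cover:
  assumes "subcubic_bipartite E" "E' \<subseteq> E" "finite C" "\<And>e. e \<in> E - E' \<Longrightarrow> e \<inter> C \<noteq> {}"
  shows "nu_ur E \<le> nu_ur E' + card C"
proof -
  obtain M where M: "uniquely_restricted E M" "card M = nu_ur E"
    using nu_ur_attained assms(1) by blast
  have m: "matching E M" using M(1) by (rule uniquely_restricted_matching)
  have fM: "finite M" using m assms(1) by (meson finite_subset matching_def subcubic_bipartite_finite)
  have "\<forall>e\<in>M - E'. \<exists>x. x \<in> e \<inter> C" using assms(4) m by (auto simp: matching_def)
  then obtain f where f: "\<And>e. e \<in> M - E' \<Longrightarrow> f e \<in> e \<inter> C" by metis
  have "inj_on f (M - E')"
    using f matching_edge_eq[OF m] by (intro inj_onI) (metis DiffD1 IntD1)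
  then have "card (M - E') \<le> card C"
    using card_inj_on_le[of f "M - E'" C] f assms(3) by blast
  moreover have "card (M \<inter> E') \<le> nu_ur E'"
    using uniquely_restricted_restrict[OF M(1) assms(2)] card_le_nu_ur assms(1,2)
      finite_subset subcubic_bipartite_finite by metis
  moreover have "card M = card (M \<inter> E') + card (M - E')"
    using fM by (metis card_Int_Diff)
  ultimately show ?thesis using M(2) by linarith
qed

lemma nu_ur_delete_le: "subcubic_bipartite E \<Longrightarrow> finite X \<Longrightarrow> nu_ur E \<le> nu_ur (delete X E) + card X"
  by (rule nu_ur_le_cover) (auto simp: delete_def)

text \<open>A rival of \<open>M\<close> covers the same vertices, so it avoids \<open>X\<close> as \<open>M\<close> does.\<close>

lemma uniquely_restricted_undelete:
  assumes "uniquely_restricted (delete X E) M"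
  shows "uniquely_restricted E M"
proof (rule uniquely_restrictedI)
  have m: "matching (delete X E) M" using assms by (rule uniquely_restricted_matching)
  then show "matching E M" using delete_subset[of X E] by (auto simp: matching_def)
  fix M' assume M': "matching E M'" "\<Union>M' = \<Union>M"
  have "\<Union>M' \<inter> X = {}" unfolding M'(2) using m by (auto simp: matching_def delete_def)
  then have "e \<inter> X = {}" if "e \<in> M'" for e using that by blast
  then have "M' \<subseteq> delete X E" using M'(1) by (auto simp: matching_def delete_def)
  then have "matching (delete X E) M'" using M'(1) by (simp add: matching_def)
  then show "M' = M" using uniquely_restrictedD[OF assms] M'(2) by blast
qed

text \<open>The reason why selections build uniquely restricted matchings: among the covered vertices,
  \<open>b\<close> is the only neighbour of \<open>x\<close>, so any rival contains the edge \<open>{x, b}\<close>, too.\<close>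

lemma uniquely_restricted_select:
  assumes "subcubic_bipartite E" "b \<in> nbr E x" "uniquely_restricted (select x E) M"
  shows "uniquely_restricted E (insert {x, b} M)" "{x, b} \<notin> M"
proof -
  have m: "matching (select x E) M" using assms(3) by (rule uniquely_restricted_matching)
  have avoid: "\<Union>M \<inter> nbr E x = {}" "x \<notin> \<Union>M"
  proof -
    show 1: "\<Union>M \<inter> nbr E x = {}" using m by (auto simp: matching_def select_def delete_def)
    show "x \<notin> \<Union>M"
    proof
      assume "x \<in> \<Union>M"
      then obtain e where e: "e \<in> M" "x \<in> e" by blast
      then have "e \<in> E" using m select_subset[of x E] by (auto simp: matching_def)
      then obtain y where "e = {x, y}" "y \<in> nbr E x" using edge_at[OF assms(1)] e(2) by metis
      then show False using 1 e(1) by blast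
    qed
  qed
  show "{x, b} \<notin> M" using avoid by blast
  show "uniquely_restricted E (insert {x, b} M)"
  proof (rule uniquely_restrictedI)
    show "matching E (insert {x, b} M)"
      using m assms(2) avoid select_subset[of x E]
      by (auto simp: matching_def pairwise_insert in_nbr disjnt_def)
    fix M' assume M': "matching E M'" "\<Union>M' = \<Union>(insert {x, b} M)"
    obtain e where e: "e \<in> M'" "x \<in> e" using M'(2) by auto
    then have "e \<in> E" using M'(1) by (auto simp: matching_def)
    then obtain y where y: "e = {x, y}" "y \<noteq> x" "y \<in> nbr E x"
      using edge_at[OF assms(1)] e(2) by metis
    moreover have "y \<in> \<Union>(insert {x, b} M)" unfolding M'(2)[symmetric] using y e by blast
    ultimately have "y = b" using avoid by auto
    then have xb: "{x, b} \<in> M'" using y e by simp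
    have cov: "\<Union>(M' - {{x, b}}) = \<Union>M"
    proof -
      have "\<Union>(M' - {{x, b}}) \<inter> {x, b} = {}"
        using matching_edge_eq[OF M'(1) xb] by blast
      moreover have "\<Union>M \<inter> {x, b} = {}" using avoid assms(2) by blast
      moreover have "\<Union>(M' - {{x, b}}) \<union> {x, b} = \<Union>M \<union> {x, b}"
      proof -
        have "\<Union>(M' - {{x, b}}) \<union> {x, b} = \<Union>M'" using xb by blast
        then show ?thesis unfolding M'(2) by blast
      qed
      moreover have "P = Q" if "P \<inter> R = {}" "Q \<inter> R = {}" "P \<union> R = Q \<union> R" for P Q R :: "'a set"
        using that by blast
      ultimately show ?thesis by meson
    qed
    have "M' - {{x, b}} \<subseteq> select x E"
    proof
      fix f assume f: "f \<in> M' - {{x, b}}"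
      then have "f \<subseteq> \<Union>M" unfolding cov[symmetric] by blast
      then have "f \<inter> nbr E x = {}" using avoid by blast
      then show "f \<in> select x E" using f M'(1) by (auto simp: select_def delete_def matching_def)
    qed
    then have "matching (select x E) (M' - {{x, b}})"
      using M'(1) by (auto simp: matching_def pairwise_def)
    then have "M' - {{x, b}} = M" using uniquely_restrictedD[OF assms(3)] cov by blast
    then show "M' = insert {x, b} M" using xb by blast
  qed
qed

text \<open>Two covered twins could exchange their partners.\<close>

lemma twins_not_both_covered:
  assumes "subcubic_bipartite E" "uniquely_restricted E M" "nbr E x = nbr E y" "x \<noteq> y"
  shows "x \<notin> \<Union>M \<or> y \<notin> \<Union>M"
proof (rule ccontr)
  assume "\<not> ?thesis"
  then obtain e f where ef: "e \<in> M" "x \<in> e" "f \<in> M" "y \<in> f" by blast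
  have m: "matching E M" using assms(2) by (rule uniquely_restricted_matching)
  have ME: "M \<subseteq> E" using m by (simp add: matching_def)
  have partner: "\<exists>w. g = {z, w} \<and> w \<noteq> z \<and> w \<in> nbr E z" if "g \<in> M" "z \<in> g" for g z
  proof -
    have "g \<in> E" using that ME by blast
    then show ?thesis using that(2) edge_at[OF assms(1)] by metis
  qed
  obtain x' where x': "e = {x, x'}" "x' \<noteq> x" "x' \<in> nbr E x" using partner ef by blast
  obtain y' where y': "f = {y, y'}" "y' \<noteq> y" "y' \<in> nbr E y" using partner ef by blast
  have irr: "x \<notin> nbr E x" "y \<notin> nbr E y" using nbr_irrefl[OF assms(1)] by auto
  have ne: "x' \<noteq> y" "y' \<noteq> x" using x' y' irr assms(3) by auto
  have ne2: "e \<noteq> f" using x' y' ne assms(4) by (auto simp: doubleton_eq_iff)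
  then have ne3: "x' \<noteq> y'" using matching_edge_eq[OF m ef(1) ef(3), of x'] x' y' by auto
  define M' where "M' = (M - {e, f}) \<union> {{x, y'}, {y, x'}}"
  have rest: "g \<inter> {x, x', y, y'} = {}" if "g \<in> M - {e, f}" for g
    using matching_edge_eq[OF m _ ef(1)] matching_edge_eq[OF m _ ef(3)] that x' y' by blast
  have "matching E M'"
    unfolding matching_def
  proof (intro conjI pairwiseI)
    have "{x, y'} \<in> E" "{y, x'} \<in> E" using x' y' assms(3) by (auto simp: nbr_def)
    then show "M' \<subseteq> E" using ME by (auto simp: M'_def)
    fix g h assume gh: "g \<in> M'" "h \<in> M'" "g \<noteq> h"
    show "disjnt g h"
    proof (cases "g \<in> M - {e, f}"; cases "h \<in> M - {e, f}")
      assume "g \<in> M - {e, f}" "h \<in> M - {e, f}"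
      then show ?thesis using gh(3) m by (auto simp: matching_def pairwise_def)
    next
      assume "g \<in> M - {e, f}" "h \<notin> M - {e, f}"
      then show ?thesis using gh(2) rest[of g] by (auto simp: M'_def disjnt_def)
    next
      assume "g \<notin> M - {e, f}" "h \<in> M - {e, f}"
      then show ?thesis using gh(1) rest[of h] by (auto simp: M'_def disjnt_def)
    next
      assume "g \<notin> M - {e, f}" "h \<notin> M - {e, f}"
      then show ?thesis using gh ne ne3 x' y' assms(4) by (auto simp: M'_def disjnt_def)
    qed
  qed
  moreover have "\<Union>M' = \<Union>M"
  proof -
    have "M = (M - {e, f}) \<union> {e, f}" using ef by blast
    then have "\<Union>M = \<Union>(M - {e, f}) \<union> (e \<union> f)" by blast
    then show ?thesis by (auto simp: M'_def x'(1) y'(1))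
  qed
  ultimately have "M' = M" using uniquely_restrictedD[OF assms(2)] by blast
  then have "{x, y'} \<in> M" by (auto simp: M'_def)
  then have "{x, y'} = e" using matching_edge_eq[OF m _ ef(1), of "{x, y'}" x] x' by auto
  then show False using x' ne3 by (auto simp: doubleton_eq_iff)
qed

text \<open>By the previous lemma the vertices covered by an optimal matching have distinct
  neighbourhoods.\<close>

lemma twice_nu_ur_le:
  assumes "subcubic_bipartite E" shows "2 * nu_ur E \<le> card (nbhds E)"
proof -
  obtain M where M: "uniquely_restricted E M" "card M = nu_ur E"
    using nu_ur_attained assms by blast
  have m: "matching E M" using M(1) by (rule uniquely_restricted_matching)
  have ME: "M \<subseteq> E" using m by (simp add: matching_def)
  have "inj_on (nbr E) (\<Union>M)"
    using twins_not_both_covered[OF assms M(1)] unfolding inj_on_def by meson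
  moreover have "nbr E ` \<Union>M \<subseteq> nbhds E" using ME by (auto simp: nbhds_def)
  moreover have "finite (nbhds E)" using subcubic_bipartite_finite_vertices[OF assms] by (simp add: nbhds_def)
  ultimately have "card (\<Union>M) \<le> card (nbhds E)" by (meson card_inj_on_le)
  moreover have "card (\<Union>M) = (\<Sum>e\<in>M. card e)"
  proof (rule card_Union_disjoint)
    show "pairwise disjnt M" using m by (simp add: matching_def)
    show "finite e" if "e \<in> M" for e
      using that ME subcubic_bipartite_card2[OF assms, of e] card.infinite by fastforce
  qed
  moreover have "(\<Sum>e\<in>M. card e) = 2 * card M"
    using subcubic_bipartite_card2[OF assms] ME by (simp add: subset_iff)
  ultimately show ?thesis using M(2) by simp
qed

text \<open>An optimal matching covers at most one of the twins, and as exchanging the twins is an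
  automorphism of the graph, this can be taken to be \<open>u\<close>.\<close>

lemma nu_ur_delete_twin:
  assumes "subcubic_bipartite E" "nbr E u = nbr E v" "u \<noteq> v"
  shows "nu_ur E \<le> nu_ur (delete {v} E)"
proof -
  obtain M where M: "uniquely_restricted E M" "card M = nu_ur E"
    using nu_ur_attained assms by blast
  have m: "matching E M" using M(1) by (rule uniquely_restricted_matching)
  have ME: "M \<subseteq> E" using m by (simp add: matching_def)
  have fin: "finite (delete {v} E)" using assms(1) delete_subset finite_subset subcubic_bipartite_finite by metis
  have avoid: ?thesis if "uniquely_restricted E N" "card N = nu_ur E" "v \<notin> \<Union>N" for N
  proof -
    have "N \<inter> delete {v} E = N"
      using that uniquely_restricted_matching[OF that(1)] by (auto simp: matching_def delete_def)
    then have "uniquely_restricted (delete {v} E) N"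
      using uniquely_restricted_restrict[OF that(1) delete_subset[of "{v}"]] by simp
    then show ?thesis using card_le_nu_ur[OF fin] that(2) by metis
  qed
  show ?thesis
  proof (cases "v \<in> \<Union>M")
    case False
    then show ?thesis using avoid M by blast
  next
    case True
    then have u: "u \<notin> \<Union>M" using twins_not_both_covered[OF assms(1) M(1) assms(2,3)] by blast
    obtain e where e: "e \<in> M" "v \<in> e" using True by blast
    define \<sigma> where "\<sigma> z = (if z = u then v else if z = v then u else z)" for z
    have inv: "\<sigma> (\<sigma> z) = z" for z using assms(3) by (auto simp: \<sigma>_def)
    have invs: "\<sigma> ` \<sigma> ` S = S" for S using inv by (simp add: image_image)
    have pres: "\<sigma> ` g \<in> E" if g: "g \<in> E" for g
    proof -
      obtain a b where ab: "g = {a, b}" using subcubic_bipartite_edge[OF assms(1) g] by metis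
      have same: "nbr E (\<sigma> z) = nbr E z" for z using assms(2) by (simp add: \<sigma>_def)
      have "b \<in> nbr E (\<sigma> a)" using g ab same by (simp add: in_nbr)
      then have "\<sigma> a \<in> nbr E (\<sigma> b)" using same nbr_sym by metis
      then show ?thesis using ab by (simp add: in_nbr insert_commute)
    qed
    have match: "matching E ((`) \<sigma> ` N)" if "matching E N" for N
      unfolding matching_def
    proof (intro conjI pairwiseI)
      show "(`) \<sigma> ` N \<subseteq> E" using that pres by (auto simp: matching_def)
      fix g h assume gh: "g \<in> (`) \<sigma> ` N" "h \<in> (`) \<sigma> ` N" "g \<noteq> h"
      then obtain g' h' where gh': "g = \<sigma> ` g'" "h = \<sigma> ` h'" "g' \<in> N" "h' \<in> N" by blast
      moreover have "g' \<noteq> h'" using gh(3) gh' by blast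
      ultimately have "g' \<inter> h' = {}" using that by (auto simp: matching_def pairwise_def disjnt_def)
      moreover have "inj \<sigma>" by (metis injI inv)
      ultimately show "disjnt g h" using gh'(1,2) by (simp add: disjnt_def flip: image_Int)
    qed
    have "uniquely_restricted E ((`) \<sigma> ` M)"
    proof (rule uniquely_restrictedI)
      show "matching E ((`) \<sigma> ` M)" by (rule match[OF m])
      fix M' assume M': "matching E M'" "\<Union>M' = \<Union>((`) \<sigma> ` M)"
      have "\<Union>((`) \<sigma> ` M') = \<sigma> ` \<Union>M'" by blast
      also have "\<dots> = \<sigma> ` \<sigma> ` \<Union>M" using M'(2) by (simp add: image_Union)
      finally have "\<Union>((`) \<sigma> ` M') = \<Union>M" using invs by simp
      then have "(`) \<sigma> ` M' = M" using uniquely_restrictedD[OF M(1) match[OF M'(1)]] by blast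
      then have "(`) \<sigma> ` (`) \<sigma> ` M' = (`) \<sigma> ` M" by simp
      then show "M' = (`) \<sigma> ` M" by (simp add: image_image inv)
    qed
    moreover have "card ((`) \<sigma> ` M) = card M"
      by (rule card_image) (metis inj_onI invs)
    moreover have "v \<notin> \<Union>((`) \<sigma> ` M)"
    proof
      assume "v \<in> \<Union>((`) \<sigma> ` M)"
      then obtain z where "z \<in> \<Union>M" "v = \<sigma> z" by blast
      then have "z = u" using assms(3) by (auto simp: \<sigma>_def split: if_splits)
      then show False using u \<open>z \<in> \<Union>M\<close> by simp
    qed
    ultimately show ?thesis using avoid M(2) by simp
  qed
qed

section \<open>Selections that pay for the loss of potential\<close>

text \<open>The weights \<open>3\<close> and \<open>1\<close> are chosen such that \<open>potential E \<ge> 5 * nu_ur E\<close> while selecting a vertex of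
  degree \<open>2\<close> without side effects costs at most \<open>9\<close>: it deletes two vertices, which lowers \<open>nu_ur\<close> by at
  most \<open>2\<close>, and it removes three neighbourhoods. Whatever isolates further vertices or makes further
  vertices twins costs more and has to be compensated by cheaper selections.\<close>

definition potential :: "'a set set \<Rightarrow> nat" where
  "potential E = 3 * nu_ur E + card (nbhds E)"

text \<open>Neighbourhoods in \<open>E\<close> of vertices from \<open>S\<close> are recovered from those in \<open>E'\<close>; only the
  neighbourhoods of vertices from \<open>Z\<close> may get lost. In the applications \<open>Z\<close> contains the vertices that
  are deleted or become isolated, and those whose neighbourhood may coincide with another one.\<close>

lemma card_nbhds_le:
  assumes "subcubic_bipartite E'" "finite Z" "nbhds E \<subseteq> nbr E ` S \<union> nbr E ` Z"
    and nonempty: "\<And>x. x \<in> S \<Longrightarrow> nbr E' x \<noteq> {}"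
    and inj: "\<And>x y. x \<in> S \<Longrightarrow> y \<in> S \<Longrightarrow> nbr E' x = nbr E' y \<Longrightarrow> nbr E x = nbr E y"
  shows "card (nbhds E) \<le> card (nbhds E') + card Z"
proof -
  have fin: "finite (nbhds E')" using subcubic_bipartite_finite_vertices[OF assms(1)] by (simp add: nbhds_def)
  have sub: "nbr E' ` S \<subseteq> nbhds E'"
    using nonempty in_vertices_iff[OF assms(1)] unfolding nbhds_def by blast
  define h where "h N = nbr E (SOME x. x \<in> S \<and> nbr E' x = N)" for N
  have h: "h (nbr E' x) = nbr E x" if "x \<in> S" for x
  proof -
    have "(SOME y. y \<in> S \<and> nbr E' y = nbr E' x) \<in> S \<and> nbr E' (SOME y. y \<in> S \<and> nbr E' y = nbr E' x) = nbr E' x"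
      using that by (intro someI[of "\<lambda>y. y \<in> S \<and> nbr E' y = nbr E' x" x]) simp
    then show ?thesis using inj that unfolding h_def by blast
  qed
  have "nbr E ` S \<subseteq> h ` nbr E' ` S" using h by (metis (no_types, lifting) image_eqI image_subsetI)
  then have "nbr E ` S \<subseteq> h ` nbhds E'" using sub by blast
  then have fS: "finite (nbr E ` S)" "card (nbr E ` S) \<le> card (nbhds E')"
    using fin by (meson finite_imageI finite_subset, meson surj_card_le)
  have "card (nbhds E) \<le> card (nbr E ` S \<union> nbr E ` Z)"
    using assms(2,3) fS(1) by (intro card_mono) auto
  also have "\<dots> \<le> card (nbr E ` S) + card (nbr E ` Z)" by (rule card_Un_le)
  also have "\<dots> \<le> card (nbhds E') + card Z"
    using fS(2) card_image_le[OF assms(2)] by (rule add_mono)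
  finally show ?thesis .
qed

lemma card_nbhds_delete_le:
  assumes "subcubic_bipartite E" "finite Z" "X \<subseteq> Z"
    and "\<And>x. x \<in> \<Union>E - Z \<Longrightarrow> \<not> nbr E x \<subseteq> X"
    and "\<And>x y. x \<in> \<Union>E - Z \<Longrightarrow> y \<in> \<Union>E - Z \<Longrightarrow> nbr E x - X = nbr E y - X \<Longrightarrow> nbr E x = nbr E y"
  shows "card (nbhds E) \<le> card (nbhds (delete X E)) + card Z"
proof (rule card_nbhds_le[where S = "\<Union>E - Z"])
  show "subcubic_bipartite (delete X E)" using assms(1) delete_subset by (rule subcubic_bipartite_subset)
  show "nbhds E \<subseteq> nbr E ` (\<Union>E - Z) \<union> nbr E ` Z" by (auto simp: nbhds_def)
qed (use assms in \<open>auto simp: nbr_delete split: if_splits\<close>)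

text \<open>The crude bound: in the worst case all vertices adjacent to a deleted vertex lose their
  neighbourhood.\<close>

lemma potential_delete_le:
  assumes "subcubic_bipartite E" "finite X"
  shows "potential E \<le> potential (delete X E) + 3 * card X + card (X \<union> \<Union>(nbr E ` X))"
proof -
  have far: "nbr E x - X = nbr E x" if "x \<notin> \<Union>(nbr E ` X)" for x
    using that nbr_symD[of _ E x] by blast
  have "card (nbhds E) \<le> card (nbhds (delete X E)) + card (X \<union> \<Union>(nbr E ` X))"
  proof (rule card_nbhds_delete_le[OF assms(1)])
    show "finite (X \<union> \<Union>(nbr E ` X))" using assms by (simp add: subcubic_bipartite_finite_nbr)
    show "\<not> nbr E x \<subseteq> X" if "x \<in> \<Union>E - (X \<union> \<Union>(nbr E ` X))" for x
    proof -
      have "nbr E x - X = nbr E x" "nbr E x \<noteq> {}"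
        using that far[of x] in_vertices_iff[OF assms(1), of x] by auto
      then show ?thesis by blast
    qed
    show "nbr E x = nbr E y"
      if "x \<in> \<Union>E - (X \<union> \<Union>(nbr E ` X))" "y \<in> \<Union>E - (X \<union> \<Union>(nbr E ` X))"
        "nbr E x - X = nbr E y - X" for x y
      using that far[of x] far[of y] by simp
  qed simp
  then show ?thesis using nu_ur_delete_le[OF assms] unfolding potential_def by simp
qed

text \<open>One vertex \<open>y\<close> is deleted, and at most four neighbourhoods are affected: its own and those of
  its at most three neighbours. The cost is at most \<open>3 + 4\<close>.\<close>

lemma potential_pendant:
  assumes "subcubic_bipartite E" "card (nbr E x) = 1"
  shows "potential E \<le> potential (select x E) + 9"
proof -
  obtain y where y: "nbr E x = {y}" using assms(2) by (auto simp: card_1_singleton_iff)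
  have "card ({y} \<union> nbr E y) \<le> 1 + 3"
    using card_Un_le[of "{y}" "nbr E y"] subcubic_bipartite_card_nbr[OF assms(1), of y] by simp
  then show ?thesis using potential_delete_le[OF assms(1), of "{y}"] y by (simp add: select_def)
qed

text \<open>Both summands of the potential stay the same, since twins count only once in either of them:
  every neighbourhood that contains one of the twins contains the other, so no two become equal.\<close>

lemma potential_twin:
  assumes "subcubic_bipartite E" "nbr E u = nbr E v" "u \<noteq> v"
  shows "potential E \<le> potential (delete {v} E)"
proof -
  have both: "u \<in> nbr E x \<longleftrightarrow> v \<in> nbr E x" for x
    using assms(2) nbr_sym[of x E] by (metis nbr_sym)
  have "card (nbhds E) \<le> card (nbhds (delete {v} E)) + card ({} :: 'a set)"
  proof (rule card_nbhds_le[where S = "\<Union>E - {v}"])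
    show "subcubic_bipartite (delete {v} E)" using assms(1) delete_subset by (rule subcubic_bipartite_subset)
    show "nbhds E \<subseteq> nbr E ` (\<Union>E - {v}) \<union> nbr E ` {}"
    proof -
      have "nbr E v \<in> nbr E ` (\<Union>E - {v})" if "v \<in> \<Union>E"
        using that assms in_vertices_iff[OF assms(1)] by (metis Diff_iff image_eqI singletonD)
      then show ?thesis unfolding nbhds_def by blast
    qed
    show "nbr (delete {v} E) x \<noteq> {}" if "x \<in> \<Union>E - {v}" for x
      using that both[of x] in_vertices_iff[OF assms(1), of x] assms(3) by (auto simp: nbr_delete)
    show "nbr E x = nbr E y"
      if "x \<in> \<Union>E - {v}" "y \<in> \<Union>E - {v}" "nbr (delete {v} E) x = nbr (delete {v} E) y" for x y
    proof -
      have "nbr E x - {v} = nbr E y - {v}" using that by (auto simp: nbr_delete)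
      then show ?thesis using both[of x] both[of y] assms(3) by blast
    qed
  qed simp
  then show ?thesis using nu_ur_delete_twin[OF assms] unfolding potential_def by simp
qed

lemma card_nbr_Diff_le:
  assumes "subcubic_bipartite E" "S \<subseteq> nbr E x" shows "card (nbr E x - S) \<le> 3 - card S"
  using subcubic_bipartite_card_nbr[OF assms(1), of x] subcubic_bipartite_finite_nbr[OF assms(1), of x] assms(2)
  by (metis card_Diff_subset diff_le_mono finite_subset)

text \<open>After the selection of \<open>s\<close>, the vertex \<open>p\<close> is pendant. Three vertices \<open>c\<close>, \<open>d\<close>, \<open>r\<close> are deleted,
  where \<open>s\<close> and \<open>p\<close> are common neighbours of \<open>c\<close> and \<open>d\<close>. This leaves room for only nine affected
  vertices: \<open>c\<close>, \<open>d\<close>, \<open>r\<close>, \<open>s\<close>, \<open>p\<close>, one more neighbour of each of \<open>c\<close> and \<open>d\<close>, and two of \<open>r\<close>. The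
  cost is \<open>3 * 3 + 9\<close> for two selections.\<close>

lemma potential_nested:
  assumes "subcubic_bipartite E" "p \<noteq> s" "nbr E s \<subseteq> nbr E p" "card (nbr E s) = 2" "nbr E s \<noteq> nbr E p"
  shows "potential E \<le> potential (select p (select s E)) + 18"
    and "nbr (select s E) p \<noteq> {}"
proof -
  obtain c d where cd: "nbr E s = {c, d}" "c \<noteq> d" using assms(4) by (auto simp: card_2_iff)
  have "card (nbr E p - nbr E s) \<le> 1"
    using card_nbr_Diff_le[OF assms(1,3)] assms(4) by simp
  moreover have "nbr E p - nbr E s \<noteq> {}" using assms(3,5) by blast
  moreover have "finite (nbr E p)" by (rule subcubic_bipartite_finite_nbr[OF assms(1)])
  ultimately have "card (nbr E p - nbr E s) = 1"
    by (metis card_0_eq finite_Diff le_neq_implies_less less_one)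
  then obtain r where r: "nbr E p - nbr E s = {r}" by (auto simp: card_1_singleton_iff)
  have sel: "nbr (select s E) p = {r}"
  proof -
    have "p \<notin> nbr E s" using assms(3) nbr_irrefl[OF assms(1)] by blast
    then show ?thesis using r by (simp add: select_def nbr_delete)
  qed
  then show "nbr (select s E) p \<noteq> {}" by simp
  have E': "select p (select s E) = delete {c, d, r} E"
    using sel cd by (simp add: select_def delete_delete insert_commute)
  have in_cd: "{s, p} \<subseteq> nbr E c" "{s, p} \<subseteq> nbr E d" "{p} \<subseteq> nbr E r"
    using cd assms(3) r nbr_symD[of _ E] by blast+
  have "{c, d, r} \<union> \<Union>(nbr E ` {c, d, r}) =
      {c, d, r, s, p} \<union> (nbr E c - {s, p}) \<union> (nbr E d - {s, p}) \<union> (nbr E r - {p})"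
    using in_cd by auto
  also have "card \<dots> \<le> 5 + 1 + 1 + 2"
  proof (intro order_trans[OF card_Un_le] add_mono)
    show "card {c, d, r, s, p} \<le> 5" using card_length[of "[c, d, r, s, p]"] by simp
    show "card (nbr E c - {s, p}) \<le> 1" "card (nbr E d - {s, p}) \<le> 1" "card (nbr E r - {p}) \<le> 2"
      using card_nbr_Diff_le[OF assms(1) in_cd(1)] card_nbr_Diff_le[OF assms(1) in_cd(2)]
        card_nbr_Diff_le[OF assms(1) in_cd(3)] assms(2) by auto
  qed
  finally have "card ({c, d, r} \<union> \<Union>(nbr E ` {c, d, r})) \<le> 9" by simp
  moreover have "card {c, d, r} = 3"
  proof -
    have "r \<notin> nbr E s" using r by blast
    then have "r \<noteq> c" "r \<noteq> d" unfolding cd(1) by blast+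
    then show ?thesis using cd(2) by (simp add: card_insert_if)
  qed
  ultimately show "potential E \<le> potential (select p (select s E)) + 18"
    using potential_delete_le[OF assms(1), of "{c, d, r}"] E' by simp
qed

text \<open>Without pendant vertices, twins and the pattern of the previous lemma, the neighbourhoods form
  an antichain (\<open>antichainI\<close> below). This limits the damage of deletions: a vertex that loses a single
  neighbour cannot become a twin of another vertex that loses at most the same neighbour.\<close>

definition antichain :: "'a set set \<Rightarrow> bool" where
  "antichain E \<longleftrightarrow> (\<forall>x\<in>\<Union>E. \<forall>y. nbr E x \<subseteq> nbr E y \<longrightarrow> x = y)"

lemma antichainD: "antichain E \<Longrightarrow> x \<in> \<Union>E \<Longrightarrow> nbr E x \<subseteq> nbr E y \<Longrightarrow> x = y"
  by (auto simp: antichain_def)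

lemma antichain_minus_one:
  assumes "antichain E" "x \<in> \<Union>E" "y \<in> \<Union>E" "nbr E x - {c} = nbr E y - {c}"
  shows "x = y"
proof (cases "c \<in> nbr E y")
  case True
  then have "nbr E x \<subseteq> nbr E y" using assms(4) by blast
  then show ?thesis using antichainD assms by metis
next
  case False
  then have "nbr E y \<subseteq> nbr E x" using assms(4) by blast
  then show ?thesis using antichainD assms by metis
qed

text \<open>Here \<open>s\<close> and \<open>p\<close> are the middle vertices of the path \<open>d - s - c - p - r\<close>; again \<open>p\<close> is pendant
  after the selection of \<open>s\<close>, and \<open>c\<close>, \<open>d\<close>, \<open>r\<close> are deleted. A third neighbour of \<open>c\<close> does not have to be
  counted among the affected vertices: if it is adjacent to neither \<open>d\<close> nor \<open>r\<close>, it loses only \<open>c\<close>, and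
  the antichain property protects it.\<close>

lemma potential_two_paths:
  assumes "subcubic_bipartite E" "antichain E" "p \<noteq> s" "nbr E s \<inter> nbr E p \<noteq> {}"
    "card (nbr E s) = 2" "card (nbr E p) = 2"
  shows "potential E \<le> potential (select p (select s E)) + 18"
    and "nbr (select s E) p \<noteq> {}"
proof -
  obtain c where c: "c \<in> nbr E s" "c \<in> nbr E p" using assms(4) by blast
  obtain d where d: "nbr E s = {c, d}" "c \<noteq> d"
    using assms(5) c(1) by (auto simp: card_2_iff doubleton_eq_iff)
  obtain r where r: "nbr E p = {c, r}" "c \<noteq> r"
    using assms(6) c(2) by (auto simp: card_2_iff doubleton_eq_iff)
  have vert: "s \<in> \<Union>E" "p \<in> \<Union>E" using in_vertices_iff[OF assms(1)] d r by blast+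
  have rd: "r \<noteq> d" using antichainD[OF assms(2) vert(1), of p] d r assms(3) by auto
  have sel: "nbr (select s E) p = {r}"
  proof -
    have "p \<notin> nbr E s"
    proof
      obtain A where A: "\<And>x y. y \<in> nbr E x \<Longrightarrow> x \<in> A \<longleftrightarrow> y \<notin> A" using subcubic_bipartite_coloring assms(1) by metis
      assume "p \<in> nbr E s"
      then show False using A[of p s] A[of c s] A[of c p] c by blast
    qed
    then show ?thesis using d r rd by (auto simp: select_def nbr_delete)
  qed
  then show "nbr (select s E) p \<noteq> {}" by simp
  have E': "select p (select s E) = delete {c, d, r} E"
    using sel d by (simp add: select_def delete_delete insert_commute)
  \<comment> \<open>Giving up all neighbours of \<open>d\<close> and \<open>r\<close> leaves only vertices that lose nothing but possibly \<open>c\<close>.\<close>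
  define Z where "Z = {c, d, r, s, p} \<union> (nbr E d - {s}) \<union> (nbr E r - {p})"
  have sub: "{s} \<subseteq> nbr E d" "{p} \<subseteq> nbr E r" using d r nbr_symD[of _ E] by blast+
  have "card Z \<le> 5 + 2 + 2"
    unfolding Z_def
  proof (intro order_trans[OF card_Un_le] add_mono)
    show "card {c, d, r, s, p} \<le> 5" using card_length[of "[c, d, r, s, p]"] by simp
    show "card (nbr E d - {s}) \<le> 2" "card (nbr E r - {p}) \<le> 2"
      using card_nbr_Diff_le[OF assms(1) sub(1)] card_nbr_Diff_le[OF assms(1) sub(2)] by auto
  qed
  have diff: "nbr E x - {c, d, r} = nbr E x - {c}" if "x \<in> \<Union>E - Z" for x
  proof -
    have "x \<notin> nbr E d" "x \<notin> nbr E r" using that by (auto simp: Z_def)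
    then show ?thesis using nbr_symD[of _ E x] by blast
  qed
  have "card (nbhds E) \<le> card (nbhds (delete {c, d, r} E)) + card Z"
  proof (rule card_nbhds_delete_le[OF assms(1)])
    show "finite Z" unfolding Z_def using subcubic_bipartite_finite_nbr[OF assms(1)] by simp
    show "{c, d, r} \<subseteq> Z" by (auto simp: Z_def)
    show "\<not> nbr E x \<subseteq> {c, d, r}" if x: "x \<in> \<Union>E - Z" for x
    proof
      assume "nbr E x \<subseteq> {c, d, r}"
      then have "nbr E x \<subseteq> nbr E s" using diff[OF x] d by blast
      then have "x = s" using antichainD[OF assms(2)] x by blast
      then show False using x by (simp add: Z_def)
    qed
    show "nbr E x = nbr E y"
      if "x \<in> \<Union>E - Z" "y \<in> \<Union>E - Z" "nbr E x - {c, d, r} = nbr E y - {c, d, r}" for x y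
      using antichain_minus_one[OF assms(2), of x y c] that diff[of x] diff[of y] by auto
  qed
  moreover have "nu_ur E \<le> nu_ur (delete {c, d, r} E) + 3"
    using nu_ur_delete_le[OF assms(1), of "{c, d, r}"] d r rd by simp
  ultimately show "potential E \<le> potential (select p (select s E)) + 18"
    using \<open>card Z \<le> 5 + 2 + 2\<close> E' unfolding potential_def by simp
qed

text \<open>The neighbours \<open>c\<close> and \<open>d\<close> of \<open>s\<close> are deleted, and only \<open>s\<close>, \<open>c\<close>, \<open>d\<close> lose their neighbourhoods, as no
  other vertex has all its neighbours among \<open>c\<close> and \<open>d\<close>. The cost is \<open>3 * 2 + 3\<close>.\<close>

lemma potential_twin_free:
  assumes "subcubic_bipartite E" "antichain E" "card (nbr E s) = 2" "inj_on (nbr (select s E)) (\<Union>(select s E))"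
  shows "potential E \<le> potential (select s E) + 9"
proof -
  obtain c d where cd: "nbr E s = {c, d}" "c \<noteq> d" using assms(3) by (auto simp: card_2_iff)
  have E': "select s E = delete {c, d} E" using cd by (simp add: select_def)
  have scb': "subcubic_bipartite (select s E)" using assms(1) select_subset by (rule subcubic_bipartite_subset)
  have no: "\<not> nbr E x \<subseteq> {c, d}" if x: "x \<in> \<Union>E - {s, c, d}" for x
    using antichainD[OF assms(2), of x s] x cd by auto
  have "card (nbhds E) \<le> card (nbhds (delete {c, d} E)) + card {s, c, d}"
  proof (rule card_nbhds_delete_le[OF assms(1)])
    show "nbr E x = nbr E y"
      if x: "x \<in> \<Union>E - {s, c, d}" and y: "y \<in> \<Union>E - {s, c, d}"
        and eq: "nbr E x - {c, d} = nbr E y - {c, d}" for x y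
    proof -
      have "nbr (select s E) x = nbr E x - {c, d}" "nbr (select s E) y = nbr E y - {c, d}"
        using x y by (auto simp: E' nbr_delete)
      moreover have "x \<in> \<Union>(select s E)" "y \<in> \<Union>(select s E)"
        unfolding in_vertices_iff[OF scb'] calculation using no[OF x] no[OF y] by simp_all
      ultimately have "x = y" using assms(4) eq by (metis inj_onD)
      then show ?thesis by simp
    qed
  qed (use no in auto)
  moreover have "card {s, c, d} \<le> 3" by (simp add: card_insert_if)
  moreover have "nu_ur E \<le> nu_ur (delete {c, d} E) + 2"
    using nu_ur_delete_le[OF assms(1), of "{c, d}"] cd by simp
  ultimately show ?thesis using E' unfolding potential_def by simp
qed

text \<open>The expensive case. The selection of \<open>s\<close> deletes \<open>c\<close> and \<open>d\<close> and thereby turns the opposite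
  vertices \<open>u\<close> and \<open>v\<close> of the cycle \<open>u - b1 - v - b2\<close> into twins. One of the twins is deleted for free.
  Then \<open>b1\<close>, \<open>u\<close>, \<open>b2\<close> are three consecutive vertices of degree \<open>2\<close>, and the selection of \<open>b1\<close> (which
  deletes \<open>u\<close> and the third neighbour \<open>w1\<close> of \<open>b1\<close>) makes \<open>b2\<close> pendant, with \<open>w2\<close> as its only neighbour.
  In total \<open>nu_ur\<close> drops by at most \<open>5\<close>, although six vertices are deleted, because the deletion of
  the twin is free. At most twelve neighbourhoods are lost, so that the three selections cost at most
  \<open>3 * 5 + 12 = 27\<close>.\<close>

lemma potential_square:
  assumes "subcubic_bipartite E" "antichain E" "nbr E s = {c, d}" "c \<noteq> d"
    and u: "nbr E u = {c, b1, b2}" and v: "nbr E v = {d, b1, b2}"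
    and "u \<noteq> v" "b1 \<noteq> b2" "c \<notin> {b1, b2}" "d \<notin> {b1, b2}"
  defines "E2 \<equiv> delete {v} (select s E)"
  shows "potential E \<le> potential (select b2 (select b1 E2)) + 27"
    and "nbr E2 b1 \<noteq> {}" and "nbr (select b1 E2) b2 \<noteq> {}"
proof -
  obtain A where A: "\<And>x y. y \<in> nbr E x \<Longrightarrow> x \<in> A \<longleftrightarrow> y \<notin> A" using subcubic_bipartite_coloring assms(1) by metis
  have b_in: "u \<in> nbr E b1" "v \<in> nbr E b1" "u \<in> nbr E b2" "v \<in> nbr E b2" "u \<in> nbr E c" "v \<in> nbr E d"
    "s \<in> nbr E c" "s \<in> nbr E d"
    using u v assms(3) nbr_symD[of _ E] by blast+
  have vert: "b1 \<in> \<Union>E" "b2 \<in> \<Union>E" using b_in in_vertices_iff[OF assms(1)] by blast+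
  obtain w1 where w1: "w1 \<in> nbr E b1" "w1 \<notin> nbr E b2"
    using antichainD[OF assms(2) vert(1), of b2] assms(8) by blast
  obtain w2 where w2: "w2 \<in> nbr E b2" "w2 \<notin> nbr E b1"
    using antichainD[OF assms(2) vert(2), of b1] assms(8) by blast
  have b1: "nbr E b1 = {u, v, w1}"
  proof (rule sym, rule card_seteq[OF subcubic_bipartite_finite_nbr[OF assms(1)]])
    have "w1 \<noteq> u" "w1 \<noteq> v" using w1 b_in by metis+
    then have "card {u, v, w1} = 3" using assms(7) by auto
    then show "card (nbr E b1) \<le> card {u, v, w1}" using subcubic_bipartite_card_nbr[OF assms(1)] by simp
  qed (use b_in w1 in auto)
  have b2: "nbr E b2 = {u, v, w2}"
  proof (rule sym, rule card_seteq[OF subcubic_bipartite_finite_nbr[OF assms(1)]])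
    have "w2 \<noteq> u" "w2 \<noteq> v" using w2 b_in by metis+
    then have "card {u, v, w2} = 3" using assms(7) by auto
    then show "card (nbr E b2) \<le> card {u, v, w2}" using subcubic_bipartite_card_nbr[OF assms(1)] by simp
  qed (use b_in w2 in auto)
  have side: "u \<in> A \<longleftrightarrow> s \<in> A" "v \<in> A \<longleftrightarrow> s \<in> A" "w1 \<in> A \<longleftrightarrow> s \<in> A" "w2 \<in> A \<longleftrightarrow> s \<in> A"
    "c \<in> A \<longleftrightarrow> s \<notin> A" "d \<in> A \<longleftrightarrow> s \<notin> A" "b1 \<in> A \<longleftrightarrow> s \<notin> A" "b2 \<in> A \<longleftrightarrow> s \<notin> A"
    using A[OF b_in(1)] A[OF b_in(2)] A[OF b_in(3)] A[OF b_in(4)] A[OF b_in(5)] A[OF b_in(6)]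
      A[OF b_in(7)] A[OF b_in(8)] A[OF w1(1)] A[OF w2(1)] by blast+
  have distinct_w: "w1 \<notin> {u, v, w2, c, d, b1, b2}" "w2 \<notin> {u, v, w1, c, d, b1, b2}"
    using w1 w2 b_in side by auto
  have distinct_uv: "u \<notin> {c, d, b1, b2}" "v \<notin> {c, d, b1, b2}" using side by auto
  have E2: "E2 = delete {v, c, d} E"
    using assms(3) by (simp add: E2_def select_def delete_delete insert_commute)
  have n1: "nbr E2 b1 = {u, w1}"
    using b1 distinct_w distinct_uv assms(7,9,10) side by (auto simp: E2 nbr_delete)
  then show "nbr E2 b1 \<noteq> {}" by simp
  have E3: "select b1 E2 = delete {u, w1, v, c, d} E"
    using n1 by (simp add: select_def E2 delete_delete insert_commute)
  have n2: "nbr (select b1 E2) b2 = {w2}"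
    using b2 distinct_w distinct_uv assms(7,9,10) side by (auto simp: E3 nbr_delete)
  then show "nbr (select b1 E2) b2 \<noteq> {}" by simp
  define X where "X = {w2, u, w1, v, c, d}"
  have E4: "select b2 (select b1 E2) = delete X E"
    unfolding select_def[of b2] n2 unfolding E3 delete_delete X_def by (simp add: insert_commute)
  have E4': "delete X E = delete {u, w1, w2} E2"
    by (simp add: E2 delete_delete X_def insert_commute)
  have scb1: "subcubic_bipartite (select s E)" using assms(1) select_subset by (rule subcubic_bipartite_subset)
  have scb2: "subcubic_bipartite E2" using assms(1) E2 delete_subset subcubic_bipartite_subset by metis
  have "nu_ur E \<le> nu_ur (select s E) + 2"
    using nu_ur_delete_le[OF assms(1), of "{c, d}"] assms(3,4) by (simp add: select_def)
  also have "nu_ur (select s E) \<le> nu_ur E2"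
  proof -
    have "nbr (select s E) u = nbr (select s E) v"
      using assms(3,9,10) u v distinct_uv by (auto simp: select_def nbr_delete)
    then show ?thesis using nu_ur_delete_twin[OF scb1 _ assms(7)] by (simp add: E2_def)
  qed
  also have "nu_ur E2 \<le> nu_ur (delete X E) + 3"
    using nu_ur_delete_le[OF scb2, of "{u, w1, w2}"] distinct_w
    by (auto simp: E4' card_insert_if split: if_splits)
  finally have nu: "nu_ur E \<le> nu_ur (delete X E) + 5" by simp
  \<comment> \<open>Besides the nine vertices that disappear, one neighbour of \<open>d\<close> and two neighbours of \<open>w2\<close> are given
    up. The remaining vertices lose at most \<open>c\<close> (if they are on the side of \<open>s\<close>) or at most \<open>w1\<close> (if they
    are on the other side), so that the antichain property protects them.\<close>
  define Z where "Z = {s, c, d, u, v, w1, w2, b1, b2} \<union> (nbr E d - {s, v}) \<union> (nbr E w2 - {b2})"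
  have sv: "s \<noteq> v" using assms(3,4) v assms(9,10) by auto
  have "card Z \<le> 9 + 1 + 2"
    unfolding Z_def
  proof (intro order_trans[OF card_Un_le] add_mono)
    show "card {s, c, d, u, v, w1, w2, b1, b2} \<le> 9"
      using card_length[of "[s, c, d, u, v, w1, w2, b1, b2]"] by simp
    show "card (nbr E d - {s, v}) \<le> 1"
      using card_nbr_Diff_le[OF assms(1), of "{s, v}" d] b_in sv by simp
    show "card (nbr E w2 - {b2}) \<le> 2"
      using card_nbr_Diff_le[OF assms(1), of "{b2}" w2] w2 nbr_sym[of b2 E w2] by simp
  qed
  have same_side: "nbr E x - X = nbr E x - {c}" if x: "x \<in> \<Union>E - Z" and "x \<in> A \<longleftrightarrow> s \<in> A" for x
  proof -
    have "x \<notin> nbr E d" using x by (auto simp: Z_def)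
    then have "d \<notin> nbr E x" using nbr_sym by metis
    moreover have "y \<in> A \<longleftrightarrow> s \<notin> A" if "y \<in> nbr E x" for y
      using A[OF that] \<open>x \<in> A \<longleftrightarrow> s \<in> A\<close> by blast
    ultimately show ?thesis using side unfolding X_def by blast
  qed
  have other_side: "nbr E x - X = nbr E x - {w1}" if x: "x \<in> \<Union>E - Z" and "\<not> (x \<in> A \<longleftrightarrow> s \<in> A)" for x
  proof -
    have "x \<notin> nbr E w2" "x \<notin> nbr E u" "x \<notin> nbr E v" using x u v by (auto simp: Z_def)
    then have "w2 \<notin> nbr E x" "u \<notin> nbr E x" "v \<notin> nbr E x" using nbr_sym by metis+
    moreover have "y \<in> A \<longleftrightarrow> s \<in> A" if "y \<in> nbr E x" for y
      using A[OF that] \<open>\<not> (x \<in> A \<longleftrightarrow> s \<in> A)\<close> by blast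
    ultimately show ?thesis using side unfolding X_def by blast
  qed
  have no: "\<not> nbr E x \<subseteq> X" if x: "x \<in> \<Union>E - Z" for x
  proof
    assume sub: "nbr E x \<subseteq> X"
    show False
    proof (cases "x \<in> A \<longleftrightarrow> s \<in> A")
      case True
      then have "nbr E x \<subseteq> nbr E s" using same_side[OF x] sub assms(3) by blast
      then have "x = s" using antichainD[OF assms(2)] x by blast
      then show False using x by (simp add: Z_def)
    next
      case False
      then have "nbr E x \<subseteq> nbr E b1" using other_side[OF x] sub b1 by blast
      then have "x = b1" using antichainD[OF assms(2)] x by blast
      then show False using x by (simp add: Z_def)
    qed
  qed
  have "card (nbhds E) \<le> card (nbhds (delete X E)) + card Z"
  proof (rule card_nbhds_delete_le[OF assms(1)])
    show "finite Z" unfolding Z_def using subcubic_bipartite_finite_nbr[OF assms(1)] by simp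
    show "X \<subseteq> Z" by (auto simp: Z_def X_def)
    show "nbr E x = nbr E y"
      if x: "x \<in> \<Union>E - Z" and y: "y \<in> \<Union>E - Z" and eq: "nbr E x - X = nbr E y - X" for x y
    proof -
      obtain z where "z \<in> nbr E x" "z \<in> nbr E y" using no[OF x] eq by blast
      then have "x \<in> A \<longleftrightarrow> y \<in> A" using A by blast
      then consider "x \<in> A \<longleftrightarrow> s \<in> A" "y \<in> A \<longleftrightarrow> s \<in> A"
        | "\<not> (x \<in> A \<longleftrightarrow> s \<in> A)" "\<not> (y \<in> A \<longleftrightarrow> s \<in> A)" by blast
      then have "x = y"
      proof cases
        case 1
        then show ?thesis
          using antichain_minus_one[OF assms(2), of x y c] x y eq same_side[OF x] same_side[OF y] by blast
      next
        case 2
        then show ?thesis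
          using antichain_minus_one[OF assms(2), of x y w1] x y eq other_side[OF x] other_side[OF y] by blast
      qed
      then show ?thesis by simp
    qed
  qed (rule no)
  then show "potential E \<le> potential (select b2 (select b1 E2)) + 27"
    using \<open>card Z \<le> 9 + 1 + 2\<close> nu E4 unfolding potential_def by simp
qed

text \<open>Twins that arise from the selection of \<open>s\<close> lie on such a cycle of length four. Both must have
  lost a neighbour and not the same one, by the antichain property; and they have degree \<open>3\<close>, since a
  twin of degree \<open>2\<close> would share a neighbour with \<open>s\<close>, which the assumption \<open>free\<close> excludes.\<close>

lemma twins_after_select:
  assumes "subcubic_bipartite E" "antichain E" "card (nbr E s) = 2"
    and free: "\<And>p. p \<noteq> s \<Longrightarrow> card (nbr E p) = 2 \<Longrightarrow> nbr E s \<inter> nbr E p = {}"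
    and "u \<noteq> v" and eq: "nbr (select s E) u = nbr (select s E) v" and "nbr (select s E) u \<noteq> {}"
  obtains c d b1 b2 where "nbr E s = {c, d}" "c \<noteq> d" "nbr E u = {c, b1, b2}" "nbr E v = {d, b1, b2}"
    "b1 \<noteq> b2" "c \<notin> {b1, b2}" "d \<notin> {b1, b2}" "nbr (select s E) u = {b1, b2}"
proof -
  define R where "R = nbr (select s E) u"
  have out: "u \<notin> nbr E s" "v \<notin> nbr E s"
    using assms(7) eq by (auto simp: select_def nbr_delete split: if_splits)
  have Ru: "nbr E u - nbr E s = R" and Rv: "nbr E v - nbr E s = R"
    using out eq by (auto simp: R_def select_def nbr_delete)
  have vert: "s \<in> \<Union>E" "u \<in> \<Union>E" "v \<in> \<Union>E"
    using assms(3,7) Ru Rv in_vertices_iff[OF assms(1)] R_def by auto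
  have us: "u \<noteq> s" "v \<noteq> s" using Ru Rv assms(7) R_def by auto
  have notsub: "\<not> nbr E s \<subseteq> nbr E u" "\<not> nbr E s \<subseteq> nbr E v"
    using antichainD[OF assms(2) vert(1)] us by metis+
  have "\<not> nbr E u \<subseteq> nbr E v" "\<not> nbr E v \<subseteq> nbr E u"
    using antichainD[OF assms(2)] vert assms(5) by metis+
  then obtain c d where cd: "c \<in> nbr E u" "c \<notin> nbr E v" "d \<in> nbr E v" "d \<notin> nbr E u" by blast
  then have cs: "c \<in> nbr E s" "d \<in> nbr E s" using Ru Rv by blast+
  have "c \<noteq> d" using cd by blast
  have s: "nbr E s = {c, d}"
  proof (rule sym, rule card_seteq[OF subcubic_bipartite_finite_nbr[OF assms(1)]])
    show "card (nbr E s) \<le> card {c, d}" using assms(3) \<open>c \<noteq> d\<close> by simp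
  qed (use cs in auto)
  have u: "nbr E u = insert c R"
    using cd(1,4) unfolding Ru[symmetric] s by blast
  have v: "nbr E v = insert d R"
    using cd(2,3) unfolding Rv[symmetric] s by blast
  have cR: "c \<notin> R" "d \<notin> R" using s Ru by auto
  have fR: "finite R" using Ru subcubic_bipartite_finite_nbr[OF assms(1), of u] by auto
  have "card (nbr E u) = Suc (card R)" using u cR fR by simp
  moreover have "card (nbr E u) \<noteq> 2" using free[OF us(1)] cs cd by blast
  moreover have "card R \<noteq> 0" using fR assms(7) R_def by simp
  moreover have "card (nbr E u) \<le> 3" by (rule subcubic_bipartite_card_nbr[OF assms(1)])
  ultimately have "card R = 2" by linarith
  then obtain b1 b2 where "R = {b1, b2}" "b1 \<noteq> b2" by (auto simp: card_2_iff)
  then show thesis using that[of c d b1 b2] s \<open>c \<noteq> d\<close> u v cR R_def by auto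
qed

text \<open>The same cost bound, expressed by data that a search for twins provides: nothing is known about
  the order in which the two common neighbours are found.\<close>

lemma potential_twins:
  assumes "subcubic_bipartite E" "antichain E" "card (nbr E s) = 2"
    and "\<And>p. p \<noteq> s \<Longrightarrow> card (nbr E p) = 2 \<Longrightarrow> nbr E s \<inter> nbr E p = {}"
    and "u \<noteq> v" and "nbr (select s E) u = nbr (select s E) v"
    and e: "nbr (select s E) u = {e1, e2}"
  defines "E2 \<equiv> delete {v} (select s E)"
  shows "potential E \<le> potential (select e2 (select e1 E2)) + 27"
    and "nbr E2 e1 \<noteq> {}" and "nbr (select e1 E2) e2 \<noteq> {}"
proof -
  have "nbr (select s E) u \<noteq> {}" using e by simp
  then obtain c d b1 b2 where *: "nbr E s = {c, d}" "c \<noteq> d" "nbr E u = {c, b1, b2}" "nbr E v = {d, b1, b2}"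
    "b1 \<noteq> b2" "c \<notin> {b1, b2}" "d \<notin> {b1, b2}" "nbr (select s E) u = {b1, b2}"
    using twins_after_select[OF assms(1-6)] by metis
  have b: "{b1, b2} = {e1, e2}" using *(8) e by simp
  then have "nbr E u = {c, e1, e2}" "nbr E v = {d, e1, e2}" "e1 \<noteq> e2" "c \<notin> {e1, e2}" "d \<notin> {e1, e2}"
    using * by (auto simp: doubleton_eq_iff)
  then show "potential E \<le> potential (select e2 (select e1 E2)) + 27"
    "nbr E2 e1 \<noteq> {}" "nbr (select e1 E2) e2 \<noteq> {}"
    using potential_square[OF assms(1,2) *(1,2)] assms(5) unfolding E2_def by blast+
qed

lemma antichainI:
  assumes "subcubic_bipartite E" and no_pendant: "\<And>x. card (nbr E x) \<noteq> 1"
    and no_twins: "\<And>x y. x \<in> \<Union>E \<Longrightarrow> nbr E x = nbr E y \<Longrightarrow> x = y"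
    and no_nested: "\<And>x y. card (nbr E x) = 2 \<Longrightarrow> nbr E x \<subseteq> nbr E y \<Longrightarrow> x = y"
  shows "antichain E"
  unfolding antichain_def
proof (intro ballI allI impI)
  fix x y assume x: "x \<in> \<Union>E" and sub: "nbr E x \<subseteq> nbr E y"
  have fin: "finite (nbr E x)" "finite (nbr E y)" using subcubic_bipartite_finite_nbr[OF assms(1)] by auto
  have "card (nbr E x) \<noteq> 0" using x fin in_vertices_iff[OF assms(1)] by simp
  moreover have "card (nbr E x) \<le> 3" by (rule subcubic_bipartite_card_nbr[OF assms(1)])
  ultimately consider "card (nbr E x) = 2" | "card (nbr E x) = 3"
    using no_pendant[of x] by linarith
  then show "x = y"
  proof cases
    case 1
    then show ?thesis using no_nested sub by blast
  next
    case 2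
    then have "nbr E x = nbr E y"
      using card_seteq[OF fin(2) sub] subcubic_bipartite_card_nbr[OF assms(1), of y] by simp
    then show ?thesis using no_twins x by blast
  qed
qed

section \<open>Cubic graphs\<close>

lemma invariant_subset_exists:
  assumes "finite A" "A \<noteq> {}" "f ` A \<subseteq> A"
  obtains C where "C \<subseteq> A" "C \<noteq> {}" "f ` C = C"
proof -
  obtain C where C: "C \<subseteq> A \<and> C \<noteq> {} \<and> f ` C \<subseteq> C"
    and least: "\<And>D. D \<subseteq> A \<and> D \<noteq> {} \<and> f ` D \<subseteq> D \<Longrightarrow> card C \<le> card D"
    using ex_has_least_nat[of "\<lambda>C. C \<subseteq> A \<and> C \<noteq> {} \<and> f ` C \<subseteq> C" A card] assms by auto
  have "card C \<le> card (f ` C)" using C by (intro least) auto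
  then have "f ` C = C" using C assms(1) by (meson card_seteq finite_subset)
  then show ?thesis using that C by blast
qed

text \<open>From a vertex \<open>x\<close> on one side, go to a neighbour \<open>g x\<close> other than its partner, and then on to the
  partner of \<open>g x\<close>. As the graph is finite, this map permutes a non-empty set \<open>C\<close> of vertices, that is, it
  runs along alternating cycles; exchanging the edges along these cycles gives a rival. Bipartiteness
  ensures that both ends of the new edges are used only once.\<close>

lemma no_perfect_uniquely_restricted:
  assumes "subcubic_bipartite E" "E \<noteq> {}" "\<And>x. x \<in> \<Union>E \<Longrightarrow> card (nbr E x) \<ge> 2" "uniquely_restricted E M"
  shows "\<Union>M \<noteq> \<Union>E"
proof
  assume perfect: "\<Union>M = \<Union>E"
  have m: "matching E M" using assms(4) by (rule uniquely_restricted_matching)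
  have ME: "M \<subseteq> E" using m by (simp add: matching_def)
  obtain S where S: "\<And>x y. y \<in> nbr E x \<Longrightarrow> x \<in> S \<longleftrightarrow> y \<notin> S" using subcubic_bipartite_coloring assms(1) by metis
  have "\<exists>y. {x, y} \<in> M \<and> y \<in> nbr E x" if x: "x \<in> \<Union>E" for x
  proof -
    obtain e where e: "e \<in> M" "x \<in> e" using x unfolding perfect[symmetric] by blast
    then have "e \<in> E" using ME by blast
    then show ?thesis using e edge_at[OF assms(1)] by metis
  qed
  then obtain p where p: "\<And>x. x \<in> \<Union>E \<Longrightarrow> {x, p x} \<in> M \<and> p x \<in> nbr E x" by metis
  have pV: "p x \<in> \<Union>E" if "x \<in> \<Union>E" for x using p[OF that] nbr_subset_vertices[of E x] by blast
  have unique: "y = p x" if "{x, y} \<in> M" "x \<in> \<Union>E" for x y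
  proof -
    have "{x, y} = {x, p x}" using matching_edge_eq[OF m that(1), of "{x, p x}" x] p that(2) by auto
    moreover have "y \<noteq> x" "p x \<noteq> x"
      using that(1) ME p[OF that(2)] nbr_irrefl[OF assms(1), of x] by (auto simp: nbr_def)
    ultimately show ?thesis by (auto simp: doubleton_eq_iff)
  qed
  have pp: "p (p x) = x" if "x \<in> \<Union>E" for x
    using unique[of "p x" x] p[OF that] pV[OF that] by (simp add: insert_commute)
  have "\<exists>y \<in> nbr E x. y \<noteq> p x" if "x \<in> \<Union>E" for x
  proof (rule ccontr)
    assume "\<not> ?thesis"
    then have "nbr E x \<subseteq> {p x}" by blast
    then have "card (nbr E x) \<le> 1" using card_mono[of "{p x}"] by auto
    then show False using assms(3)[OF that] by simp
  qed
  then obtain g where g: "\<And>x. x \<in> \<Union>E \<Longrightarrow> g x \<in> nbr E x \<and> g x \<noteq> p x" by metis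
  have gV: "g x \<in> \<Union>E" if "x \<in> \<Union>E" for x using g[OF that] nbr_subset_vertices[of E x] by blast
  define A where "A = \<Union>E \<inter> S"
  have AV: "x \<in> \<Union>E" if "x \<in> A" for x using that by (simp add: A_def)
  have "A \<noteq> {}"
  proof -
    obtain e where "e \<in> E" using assms(2) by blast
    then obtain x where "x \<in> \<Union>E" using edge_at subcubic_bipartite_edge[OF assms(1)] by (metis UnionI insertI1)
    then show ?thesis using S[of "p x" x] p[of x] pV[of x] unfolding A_def by blast
  qed
  moreover have "finite A" using subcubic_bipartite_finite_vertices[OF assms(1)] by (simp add: A_def)
  moreover have "(\<lambda>x. p (g x)) ` A \<subseteq> A"
  proof
    fix y assume "y \<in> (\<lambda>x. p (g x)) ` A"
    then obtain x where x: "x \<in> A" "y = p (g x)" by blast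
    have "p (g x) \<in> S"
      using S[of "g x" x] S[of "p (g x)" "g x"] g[OF AV[OF x(1)]] p[OF gV[OF AV[OF x(1)]]] x(1)
      unfolding A_def by blast
    then show "y \<in> A" using x pV[OF gV[OF AV[OF x(1)]]] by (simp add: A_def)
  qed
  ultimately obtain C where C: "C \<subseteq> A" "C \<noteq> {}" "(\<lambda>x. p (g x)) ` C = C"
    by (metis invariant_subset_exists)
  have finC: "finite C" using C(1) \<open>finite A\<close> finite_subset by blast
  have injC: "inj_on (\<lambda>x. p (g x)) C" using C(3) finC by (simp add: eq_card_imp_inj_on)
  have gC: "g ` C = p ` C"
  proof -
    have "p ` C = (\<lambda>x. p (p (g x))) ` C" using C(3) by (metis image_image)
    also have "\<dots> = g ` C" using pp[OF gV[OF AV]] C(1) by (intro image_cong) auto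
    finally show ?thesis by simp
  qed
  define h where "h x = (if x \<in> C then g x else p x)" for x
  have p_inj: "x = y" if "p x = p y" "x \<in> A" "y \<in> A" for x y
    using pp[OF AV[OF that(2)]] pp[OF AV[OF that(3)]] that(1) by metis
  have h_inj: "x = y" if "h x = h y" "x \<in> A" "y \<in> A" for x y
  proof -
    have mixed: False if "x \<in> C" "y \<notin> C" "y \<in> A" "g x = p y" for x y
    proof -
      have "p y \<in> p ` C" using that gC by (metis imageI)
      then show False using p_inj that C(1) by blast
    qed
    show ?thesis
    proof (cases "x \<in> C"; cases "y \<in> C")
      assume "x \<in> C" "y \<in> C"
      then show ?thesis using that(1) injC by (auto simp: h_def inj_on_def)
    next
      assume "x \<in> C" "y \<notin> C"
      then show ?thesis using mixed[of x y] that by (simp add: h_def)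
    next
      assume "x \<notin> C" "y \<in> C"
      then show ?thesis using mixed[of y x] that by (simp add: h_def)
    next
      assume "x \<notin> C" "y \<notin> C"
      then show ?thesis using p_inj that by (simp add: h_def)
    qed
  qed
  have h_nbr: "h x \<in> nbr E x" if "x \<in> A" for x using g[OF AV[OF that]] p[OF AV[OF that]] by (simp add: h_def)
  have h_side: "h x \<notin> S" if "x \<in> A" for x using S[OF h_nbr[OF that]] that by (simp add: A_def)
  define M' where "M' = (\<lambda>x. {x, h x}) ` A"
  have "matching E M'"
    unfolding matching_def
  proof (intro conjI pairwiseI)
    show "M' \<subseteq> E" using h_nbr by (auto simp: M'_def nbr_def)
    fix e f assume "e \<in> M'" "f \<in> M'" "e \<noteq> f"
    then obtain x y where xy: "e = {x, h x}" "f = {y, h y}" "x \<in> A" "y \<in> A" by (auto simp: M'_def)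
    then have "x \<noteq> y" using \<open>e \<noteq> f\<close> by blast
    moreover have "h x \<noteq> h y" using h_inj xy(3,4) calculation by blast
    moreover have "x \<noteq> h y" "y \<noteq> h x" using h_side[OF xy(3)] h_side[OF xy(4)] xy(3,4) by (auto simp: A_def)
    ultimately show "disjnt e f" using xy(1,2) by (simp add: disjnt_def)
  qed
  moreover have "\<Union>M' = \<Union>M"
  proof -
    have "h ` A = p ` A"
    proof -
      have "A = C \<union> (A - C)" using C(1) by blast
      then have "h ` A = h ` C \<union> h ` (A - C)" by blast
      also have "h ` C = g ` C" by (simp add: h_def)
      also have "h ` (A - C) = p ` (A - C)" by (simp add: h_def)
      also have "g ` C \<union> p ` (A - C) = p ` A" unfolding gC using C(1) by blast
      finally show ?thesis .
    qed
    moreover have "\<Union>M' = A \<union> h ` A" by (auto simp: M'_def)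
    moreover have "A \<union> p ` A = \<Union>E"
    proof
      show "A \<union> p ` A \<subseteq> \<Union>E" using AV pV by blast
      show "\<Union>E \<subseteq> A \<union> p ` A"
      proof
        fix x assume x: "x \<in> \<Union>E"
        show "x \<in> A \<union> p ` A"
        proof (cases "x \<in> S")
          case False
          then have "p x \<in> A" using S[of "p x" x] p[OF x] pV[OF x] by (simp add: A_def)
          then show ?thesis using pp[OF x] by (metis UnI2 imageI)
        qed (use x in \<open>simp add: A_def\<close>)
      qed
    qed
    ultimately show ?thesis using perfect by simp
  qed
  ultimately have "M' = M" using uniquely_restrictedD[OF assms(4)] by blast
  obtain x where x: "x \<in> C" using C(2) by blast
  then have "{x, g x} \<in> M" using C(1) \<open>M' = M\<close> by (auto simp: M'_def h_def intro: image_eqI[of _ _ x])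
  then have "g x = p x" using unique AV C(1) x by blast
  then show False using g AV C(1) x by blast
qed

lemma exists_vertex_nu_ur_delete:
  assumes "subcubic_bipartite E" "E \<noteq> {}" "\<And>x. x \<in> \<Union>E \<Longrightarrow> card (nbr E x) \<ge> 2"
  obtains a where "a \<in> \<Union>E" "nu_ur E \<le> nu_ur (delete {a} E)"
proof -
  obtain M where M: "uniquely_restricted E M" "card M = nu_ur E"
    using nu_ur_attained assms(1) by blast
  have ME: "M \<subseteq> E" using uniquely_restricted_matching[OF M(1)] by (simp add: matching_def)
  have "\<Union>M \<subseteq> \<Union>E" using ME by blast
  then obtain a where a: "a \<in> \<Union>E" "a \<notin> \<Union>M"
    using no_perfect_uniquely_restricted[OF assms M(1)] by blast
  have "M \<inter> delete {a} E = M" using ME a(2) by (auto simp: delete_def)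
  then have "uniquely_restricted (delete {a} E) M"
    using uniquely_restricted_restrict[OF M(1) delete_subset[of "{a}"]] by simp
  moreover have "finite (delete {a} E)" using delete_subset subcubic_bipartite_finite[OF assms(1)] by (rule finite_subset)
  ultimately show ?thesis using that a(1) card_le_nu_ur M(2) by metis
qed

text \<open>No edge of \<open>E\<close> leaves the vertex set of \<open>E'\<close>, as its vertices have the maximum possible degree
  already in \<open>E'\<close>.\<close>

lemma cubic_subgraph_of_connected:
  assumes "subcubic_bipartite E" "connected_graph V E" "\<Union>E \<subseteq> V"
    and "E' \<subseteq> E" "E' \<noteq> {}" "\<And>x. x \<in> \<Union>E' \<Longrightarrow> card (nbr E' x) = 3"
  shows "E' = E"
proof -
  have scb': "subcubic_bipartite E'" using assms(1,4) by (rule subcubic_bipartite_subset)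
  have same: "nbr E' x = nbr E x" if "x \<in> \<Union>E'" for x
    using card_seteq[OF subcubic_bipartite_finite_nbr[OF assms(1)] nbr_mono[OF assms(4)]]
      assms(6)[OF that] subcubic_bipartite_card_nbr[OF assms(1), of x] by simp
  obtain e where "e \<in> E'" using assms(5) by blast
  then obtain v where v: "v \<in> \<Union>E'" using subcubic_bipartite_edge[OF scb'] by (metis UnionI insertI1)
  have reach: "x \<in> \<Union>E'" if "(v, x) \<in> {(x, y). {x, y} \<in> E}\<^sup>*" for x
    using that
  proof (induction rule: rtrancl_induct)
    case base then show ?case by (rule v)
  next
    case (step y z)
    then have "z \<in> nbr E' y" using same[OF step.IH] by (simp add: nbr_def)
    then show ?case using nbr_subset_vertices[of E' y] by blast
  qed
  have "e \<in> E'" if e: "e \<in> E" for e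
  proof -
    obtain a b where ab: "e = {a, b}" using subcubic_bipartite_edge[OF assms(1) e] by metis
    then have "a \<in> V" "v \<in> V" using e assms(3,4) v by blast+
    then have "a \<in> \<Union>E'" using reach assms(2) by (simp add: connected_graph_def)
    then show ?thesis using same[of a] e ab by (auto simp: nbr_def)
  qed
  then show ?thesis using assms(4) by blast
qed

section \<open>The algorithm on edge lists\<close>

type_synonym edges = "(nat \<times> nat) list"

abbreviation edge :: "nat \<times> nat \<Rightarrow> nat set" where
  "edge \<equiv> \<lambda>(u, v). {u, v}"

definition edge_set :: "edges \<Rightarrow> nat set set" where
  "edge_set es = set (map edge es)"

fun nbrs :: "nat \<Rightarrow> edges \<Rightarrow> nat list" where
  "nbrs x [] = []"
| "nbrs x ((u, v) # es) =
    (if x = u then v # nbrs x es else if x = v then u # nbrs x es else nbrs x es)"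

fun del :: "nat \<Rightarrow> edges \<Rightarrow> edges" where
  "del x [] = []"
| "del x ((u, v) # es) = (if x = u then del x es else if x = v then del x es else (u, v) # del x es)"

fun dels :: "nat list \<Rightarrow> edges \<Rightarrow> edges" where
  "dels [] es = es"
| "dels (x # xs) es = dels xs (del x es)"

text \<open>The local patterns are numbered, since the program has no functions as values and passes the
  pattern to a common search loop as a number.\<close>

abbreviation (input) "pendant_test \<equiv> 0 :: nat"
abbreviation (input) "twin_test \<equiv> 1 :: nat"
abbreviation (input) "nested_test \<equiv> 2 :: nat"
abbreviation (input) "meeting_test \<equiv> 3 :: nat"
abbreviation (input) "degree_two_test \<equiv> 4 :: nat"

definition test :: "nat \<Rightarrow> nat \<Rightarrow> nat \<Rightarrow> edges \<Rightarrow> bool" where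
  "test m x y es =
    (if m = pendant_test then length (nbrs x es) = 1
     else if m = degree_two_test then length (nbrs x es) = 2
     else if x = y then False
     else if m = twin_test then
       nbrs x es \<noteq> [] \<and> set (nbrs x es) \<subseteq> set (nbrs y es) \<and> set (nbrs y es) \<subseteq> set (nbrs x es)
     else if length (nbrs x es) = 2 then
       if m = nested_test then set (nbrs x es) \<subseteq> set (nbrs y es)
       else length (nbrs y es) = 2 \<and> set (nbrs x es) \<inter> set (nbrs y es) \<noteq> {}
     else False)"

fun search :: "nat \<Rightarrow> (nat \<times> nat) list \<Rightarrow> edges \<Rightarrow> (nat \<times> nat) option" where
  "search m [] es = None"
| "search m ((x, y) # ps) es = (if test m x y es then Some (x, y) else search m ps es)"

text \<open>Agrees with the primitive \<open>Car\<close>, which yields \<open>Atom 0\<close> for the empty list.\<close>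

definition hd0 :: "nat list \<Rightarrow> nat" where
  "hd0 xs = (case xs of [] \<Rightarrow> 0 | x # _ \<Rightarrow> x)"

text \<open>A state consists of the remaining edges and the matching found so far.\<close>

fun sel :: "nat \<Rightarrow> edges \<times> edges \<Rightarrow> edges \<times> edges" where
  "sel x (es, out) =
    (case nbrs x es of [] \<Rightarrow> (es, out) | b # _ \<Rightarrow> (dels (nbrs x es) es, (x, b) # out))"

text \<open>The treatment of twins right after the selection of a vertex of degree \<open>2\<close>. It belongs to the
  same step, because only the three selections together pay for the loss of potential.\<close>

definition finish :: "(nat \<times> nat) list \<Rightarrow> edges \<times> edges \<Rightarrow> edges \<times> edges" where
  "finish ps st =
    (case search twin_test ps (fst st) of
       None \<Rightarrow> st
     | Some (u, v) \<Rightarrow>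
         sel (hd0 (tl (nbrs u (fst st)))) (sel (hd0 (nbrs u (fst st))) (del v (fst st), snd st)))"

text \<open>The order of the patterns matters: from the third on, the cost bounds rely on the absence of the
  earlier patterns.\<close>

definition step :: "(nat \<times> nat) list \<Rightarrow> edges \<times> edges \<Rightarrow> edges \<times> edges" where
  "step ps st =
    (case search pendant_test ps (fst st) of Some (x, y) \<Rightarrow> sel x st | None \<Rightarrow>
    (case search twin_test ps (fst st) of Some (x, y) \<Rightarrow> (del y (fst st), snd st) | None \<Rightarrow>
    (case search nested_test ps (fst st) of Some (x, y) \<Rightarrow> sel y (sel x st) | None \<Rightarrow>
    (case search meeting_test ps (fst st) of Some (x, y) \<Rightarrow> sel y (sel x st) | None \<Rightarrow>
    (case search degree_two_test ps (fst st) of Some (x, y) \<Rightarrow> finish ps (sel x st) | None \<Rightarrow> st)))))"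

text \<open>The list \<open>fuel\<close> only serves as a counter. The input edges themselves can play this role, since
  every step with an effect deletes an edge.\<close>

fun iter :: "(nat \<times> nat) list \<Rightarrow> edges \<Rightarrow> edges \<times> edges \<Rightarrow> edges \<times> edges" where
  "iter ps [] st = st"
| "iter ps (_ # fuel) st = iter ps fuel (step ps st)"

text \<open>The list \<open>as\<close> contains the vertices that are deleted in advance, one for each attempt.\<close>

fun best :: "(nat \<times> nat) list \<Rightarrow> edges \<Rightarrow> nat list \<Rightarrow> edges \<Rightarrow> edges" where
  "best ps es [] cur = cur"
| "best ps es (a # as) cur =
    best ps es as
      (if length cur < length (snd (iter ps es (del a es, []))) then snd (iter ps es (del a es, []))
       else cur)"

fun down :: "nat \<Rightarrow> nat list" where
  "down 0 = [0]"
| "down (Suc k) = Suc k # down k"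

fun row :: "nat \<Rightarrow> nat list \<Rightarrow> (nat \<times> nat) list \<Rightarrow> (nat \<times> nat) list" where
  "row x [] ps = ps"
| "row x (y # ys) ps = (x, y) # row x ys ps"

fun pairs :: "nat list \<Rightarrow> nat list \<Rightarrow> (nat \<times> nat) list" where
  "pairs [] ys = []"
| "pairs (x # xs) ys = row x ys (pairs xs ys)"

text \<open>The number \<open>n\<close>, which is not a vertex, is included in \<open>down n\<close>: deleting it in advance amounts
  to working on the graph itself.\<close>

definition approximate_matching :: "nat \<Rightarrow> edges \<Rightarrow> edges" where
  "approximate_matching n es = best (pairs (down n) (down n)) es (down n) []"

definition represents :: "edges \<Rightarrow> nat set set \<Rightarrow> bool" where
  "represents es E \<longleftrightarrow> distinct (map edge es) \<and> edge_set es = E"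

lemma set_nbrs: "set (nbrs x es) = nbr (edge_set es) x"
  by (induction x es rule: nbrs.induct) (auto simp: edge_set_def nbr_def doubleton_eq_iff)

lemma distinct_nbrs: "distinct (map edge es) \<Longrightarrow> distinct (nbrs x es)"
proof (induction x es rule: nbrs.induct)
  case (2 x u v es)
  moreover have "y \<in> set (nbrs x es) \<longleftrightarrow> {x, y} \<in> edge ` set es" for y
    using set_nbrs[of x es] by (simp add: edge_set_def nbr_def)
  ultimately show ?case by (auto simp: insert_commute)
qed simp

lemma length_nbrs: "represents es E \<Longrightarrow> length (nbrs x es) = card (nbr E x)"
  by (metis distinct_card distinct_nbrs represents_def set_nbrs)

lemma nbrs_eq_Nil: "represents es E \<Longrightarrow> nbrs x es = [] \<longleftrightarrow> nbr E x = {}"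
  by (metis represents_def set_empty set_nbrs)

lemma del_eq_filter: "del x es = filter (\<lambda>(u, v). x \<noteq> u \<and> x \<noteq> v) es"
  by (induction x es rule: del.induct) simp_all

lemma length_del: "length (del x es) \<le> length es"
  by (simp add: del_eq_filter)

lemma length_dels: "length (dels xs es) \<le> length es"
  by (induction xs es rule: dels.induct) (auto intro: le_trans[OF _ length_del])

lemma represents_del:
  assumes "represents es E" shows "represents (del x es) (delete {x} E)"
proof -
  have "edge_set (del x es) = delete {x} (edge_set es)"
    by (auto simp: edge_set_def delete_def del_eq_filter)
  then show ?thesis
    using assms distinct_map_filter unfolding represents_def del_eq_filter by blast
qed

lemma represents_dels:
  "represents es E \<Longrightarrow> represents (dels xs es) (delete (set xs) E)"
proof (induction xs es arbitrary: E rule: dels.induct)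
  case (1 es)
  then show ?case by (simp add: delete_def)
next
  case (2 x xs es)
  then show ?case using represents_del[OF 2(2), of x] 2(1) by (fastforce simp: delete_delete)
qed

lemma represents_length: "represents es E \<Longrightarrow> length es = card E"
  by (metis distinct_card edge_set_def length_map represents_def)

lemma represents_length_less:
  assumes "represents es E" "represents es' E'" "subcubic_bipartite E" "E' \<subset> E"
  shows "length es' < length es"
  using assms by (metis psubset_card_mono represents_length subcubic_bipartite_finite)

text \<open>The matching \<open>F\<close> put out so far completes every solution for the remaining graph \<open>E\<close> to one for
  the input graph \<open>E0\<close>. Stated for all \<open>M\<close>, this is preserved by all steps, however well they are
  chosen.\<close>

definition lifts :: "nat set set \<Rightarrow> nat set set \<Rightarrow> nat set set \<Rightarrow> bool" where
  "lifts E0 F E \<longleftrightarrow>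
    (\<forall>M. uniquely_restricted E M \<longrightarrow> uniquely_restricted E0 (F \<union> M) \<and> F \<inter> M = {})"

definition sound :: "nat set set \<Rightarrow> edges \<times> edges \<Rightarrow> bool" where
  "sound E0 st \<longleftrightarrow>
    (\<exists>E \<subseteq> E0. represents (fst st) E \<and> lifts E0 (edge_set (snd st)) E \<and> distinct (map edge (snd st)))"

lemma sound_del:
  assumes "sound E0 (es, out)" shows "sound E0 (del x es, out)"
proof -
  obtain E where E: "E \<subseteq> E0" "represents es E" "lifts E0 (edge_set out) E" "distinct (map edge out)"
    using assms by (auto simp: sound_def)
  have "lifts E0 (edge_set out) (delete {x} E)"
    using E(3) uniquely_restricted_undelete unfolding lifts_def by blast
  then show ?thesis
    using represents_del[OF E(2)] E delete_subset[of "{x}" E] unfolding sound_def by auto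
qed

lemma represents_sel:
  assumes "represents es E" "nbr E x \<noteq> {}"
  shows "represents (fst (sel x (es, out))) (select x E)"
    and "length (snd (sel x (es, out))) = Suc (length out)"
  using represents_dels[OF assms(1), of "nbrs x es"] assms nbrs_eq_Nil[OF assms(1), of x] set_nbrs[of x es]
  by (auto simp: select_def represents_def split: list.split)

lemma sound_sel:
  assumes "subcubic_bipartite E0" "sound E0 st" shows "sound E0 (sel x st)"
proof -
  obtain es out where st: "st = (es, out)" by force
  obtain E where E: "E \<subseteq> E0" "represents es E" "lifts E0 (edge_set out) E" "distinct (map edge out)"
    using assms st by (auto simp: sound_def)
  have scb: "subcubic_bipartite E" using assms(1) E(1) by (rule subcubic_bipartite_subset)
  show ?thesis
  proof (cases "nbrs x es")
    case Nil
    then show ?thesis using assms(2) st by simp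
  next
    case (Cons b bs)
    then have b: "b \<in> nbr E x" using set_nbrs[of x es] E(2) by (auto simp: represents_def)
    have sel: "sel x st = (dels (nbrs x es) es, (x, b) # out)" using st Cons by simp
    have rep: "represents (dels (nbrs x es) es) (select x E)"
      using represents_dels[OF E(2), of "nbrs x es"] set_nbrs[of x es] E(2)
      by (simp add: select_def represents_def)
    have sub: "select x E \<subseteq> E0" using select_subset[of x E] E(1) by blast
    have "lifts E0 (edge_set ((x, b) # out)) (select x E)"
      unfolding lifts_def
    proof (intro allI impI)
      fix M assume M: "uniquely_restricted (select x E) M"
      then have "uniquely_restricted E (insert {x, b} M)" "{x, b} \<notin> M"
        using uniquely_restricted_select[OF scb b] by auto
      then show "uniquely_restricted E0 (edge_set ((x, b) # out) \<union> M) \<and> edge_set ((x, b) # out) \<inter> M = {}"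
        using E(3) unfolding lifts_def by (fastforce simp: edge_set_def)
    qed
    moreover have "{x, b} \<notin> edge_set out"
    proof -
      have "uniquely_restricted E (insert {x, b} {})"
        using uniquely_restricted_select[OF scb b, of "{}"]
          uniquely_restricted_empty[OF subcubic_bipartite_subset[OF scb select_subset]] by blast
      then show ?thesis using E(3) unfolding lifts_def by blast
    qed
    ultimately show ?thesis using rep sub E(4) unfolding sel sound_def by (auto simp: edge_set_def)
  qed
qed

lemma sound_finish: "subcubic_bipartite E0 \<Longrightarrow> sound E0 st \<Longrightarrow> sound E0 (finish ps st)"
  by (auto simp: finish_def simp del: sel.simps split: option.split intro!: sound_sel sound_del)

lemma sound_step: "subcubic_bipartite E0 \<Longrightarrow> sound E0 st \<Longrightarrow> sound E0 (step ps st)"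
  by (auto simp: step_def simp del: sel.simps split: option.split
      intro!: sound_sel sound_del sound_finish)

lemma sound_iter: "subcubic_bipartite E0 \<Longrightarrow> sound E0 st \<Longrightarrow> sound E0 (iter ps fuel st)"
  by (induction ps fuel st rule: iter.induct) (auto intro: sound_step)

lemma search_Some: "search m ps es = Some (x, y) \<Longrightarrow> test m x y es"
  by (induction m ps es rule: search.induct) (auto split: if_splits)

lemma search_None: "search m ps es = None \<Longrightarrow> (x, y) \<in> set ps \<Longrightarrow> \<not> test m x y es"
  by (induction m ps es rule: search.induct) (auto split: if_splits)

lemma search_Nil: "search m ps [] = None"
  by (induction m ps "[] :: edges" rule: search.induct) (auto simp: test_def)

text \<open>Each edge that is put out pays for nine units of lost potential.\<close>

definition pays :: "nat set set \<Rightarrow> edges \<times> edges \<Rightarrow> edges \<times> edges \<Rightarrow> bool" where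
  "pays E st st' \<longleftrightarrow>
    (\<exists>E' \<subset> E. represents (fst st') E' \<and>
      potential E + 9 * length (snd st) \<le> potential E' + 9 * length (snd st'))"

lemma select_psubset:
  assumes "nbr E x \<noteq> {}" shows "select x E \<subset> E"
proof -
  obtain y where y: "y \<in> nbr E x" using assms by blast
  then have "{x, y} \<in> E - select x E" by (auto simp: in_nbr select_def delete_def)
  then show ?thesis using select_subset[of x E] by blast
qed

lemma delete_psubset:
  assumes "nbr E x \<noteq> {}" shows "delete {x} E \<subset> E"
proof -
  obtain y where "y \<in> nbr E x" using assms by blast
  then have "{x, y} \<in> E - delete {x} E" by (auto simp: in_nbr delete_def)
  then show ?thesis using delete_subset[of "{x}" E] by blast
qed

lemma pays_sel:
  assumes "represents es E" "nbr E x \<noteq> {}" "potential E \<le> potential (select x E) + 9"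
  shows "pays E (es, out) (sel x (es, out))"
  using represents_sel[OF assms(1,2), of out] select_psubset[OF assms(2)] assms(3)
  unfolding pays_def by (intro exI[of _ "select x E"]) simp

lemma pays_sel_sel:
  assumes "represents es E" "nbr E x \<noteq> {}" "nbr (select x E) y \<noteq> {}"
    "potential E \<le> potential (select y (select x E)) + 18"
  shows "pays E (es, out) (sel y (sel x (es, out)))"
proof -
  obtain es1 out1 where st1: "sel x (es, out) = (es1, out1)" by force
  have 1: "represents es1 (select x E)" "length out1 = Suc (length out)"
    using represents_sel[OF assms(1,2), of out] st1 by auto
  have "select y (select x E) \<subset> E"
    using select_psubset[OF assms(2)] select_psubset[OF assms(3)] by blast
  then show ?thesis
    using represents_sel[OF 1(1) assms(3), of out1] 1(2) assms(4)
    unfolding pays_def st1 by (intro exI[of _ "select y (select x E)"]) simp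
qed

text \<open>As long as the graph has a vertex whose degree is not \<open>3\<close>, one of the patterns is found. Each
  unsuccessful search supplies a hypothesis of the cost bounds for the later patterns.\<close>

lemma step_pays:
  assumes "subcubic_bipartite E" "represents es E" "\<Union>E \<subseteq> W" "set ps = W \<times> W"
    and "x0 \<in> \<Union>E" "card (nbr E x0) \<noteq> 3"
  shows "pays E (es, out) (step ps (es, out))"
proof -
  have set_n: "set (nbrs x es) = nbr E x" for x
    using assms(2) set_nbrs[of x es] by (simp add: represents_def)
  have len_n: "length (nbrs x es) = card (nbr E x)" for x using assms(2) by (rule length_nbrs)
  have vert: "nbr E x \<noteq> {} \<Longrightarrow> x \<in> W" for x using in_vertices_iff[OF assms(1), of x] assms(3) by blast
  have pair: "nbr E x \<noteq> {} \<Longrightarrow> nbr E y \<noteq> {} \<Longrightarrow> (x, y) \<in> set ps" for x y using vert assms(4) by blast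
  show ?thesis
  proof (cases "search 0 ps es")
    case (Some xy)
    then obtain x y where xy: "search 0 ps es = Some (x, y)" by force
    then have "card (nbr E x) = 1" using search_Some[OF xy] len_n by (simp add: test_def)
    then show ?thesis
      using pays_sel[OF assms(2) _ potential_pendant[OF assms(1)], of x out] xy
      by (force simp: step_def)
  next
    case none0: None
    have pend: "card (nbr E x) \<noteq> 1" for x
      using search_None[OF none0 pair[of x x]] len_n by (force simp: test_def)
    show ?thesis
    proof (cases "search 1 ps es")
      case (Some xy)
      then obtain x y where xy: "search 1 ps es = Some (x, y)" by force
      then have t: "x \<noteq> y" "nbr E x \<noteq> {}" "nbr E x = nbr E y"
        using search_Some[OF xy] set_n[of x] set_n[of y] by (auto simp: test_def split: if_splits)
      have "delete {y} E \<subset> E" using delete_psubset t by metis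
      then show ?thesis
        using represents_del[OF assms(2), of y] potential_twin[OF assms(1) t(3,1)] none0 xy
        unfolding pays_def step_def by (intro exI[of _ "delete {y} E"]) simp
    next
      case none1: None
      have twin: "x = y" if "x \<in> \<Union>E" "nbr E x = nbr E y" for x y
      proof (rule ccontr)
        assume "x \<noteq> y"
        moreover have "nbr E x \<noteq> {}" using that in_vertices_iff[OF assms(1)] by blast
        ultimately show False
          using search_None[OF none1 pair[of x y]] that(2) set_n[of x] set_n[of y]
          by (auto simp: test_def)
      qed
      show ?thesis
      proof (cases "search 2 ps es")
        case (Some xy)
        then obtain x y where xy: "search 2 ps es = Some (x, y)" by force
        then have t: "y \<noteq> x" "nbr E x \<subseteq> nbr E y" "card (nbr E x) = 2"
          using search_Some[OF xy] set_n[of x] set_n[of y] len_n[of x]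
          by (auto simp: test_def split: if_splits)
        have ne: "nbr E x \<noteq> {}" using t(3) by auto
        have "nbr E x \<noteq> nbr E y" using twin t(1) ne in_vertices_iff[OF assms(1)] by metis
        then show ?thesis
          using pays_sel_sel[OF assms(2) ne] potential_nested[OF assms(1) t] none0 none1 xy
          by (simp add: step_def)
      next
        case none2: None
        have nested: "x = y" if "card (nbr E x) = 2" "nbr E x \<subseteq> nbr E y" for x y
        proof (rule ccontr)
          assume "x \<noteq> y"
          moreover have "nbr E x \<noteq> {}" "nbr E y \<noteq> {}" using that by auto
          ultimately show False
            using search_None[OF none2 pair[of x y]] that set_n[of x] set_n[of y] len_n[of x]
            by (auto simp: test_def)
        qed
        have anti: "antichain E" using antichainI[OF assms(1)] pend twin nested by blast
        show ?thesis
        proof (cases "search 3 ps es")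
          case (Some xy)
          then obtain x y where xy: "search 3 ps es = Some (x, y)" by force
          then have t: "y \<noteq> x" "nbr E x \<inter> nbr E y \<noteq> {}" "card (nbr E x) = 2" "card (nbr E y) = 2"
            using search_Some[OF xy] set_n[of x] set_n[of y] len_n[of x] len_n[of y]
            by (auto simp: test_def split: if_splits)
          have ne: "nbr E x \<noteq> {}" using t(3) by auto
          show ?thesis
            using pays_sel_sel[OF assms(2) ne] potential_two_paths[OF assms(1) anti t] none0 none1 none2 xy
            by (simp add: step_def)
        next
          case none3: None
          have apart: "nbr E x \<inter> nbr E y = {}"
            if "y \<noteq> x" "card (nbr E x) = 2" "card (nbr E y) = 2" for x y
          proof (rule ccontr)
            assume "nbr E x \<inter> nbr E y \<noteq> {}"
            moreover from this have "nbr E x \<noteq> {}" "nbr E y \<noteq> {}" by auto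
            ultimately show False
              using search_None[OF none3 pair[of x y]] that set_n[of x] set_n[of y] len_n[of x] len_n[of y]
              by (auto simp: test_def)
          qed
          have "\<exists>x. card (nbr E x) = 2"
          proof -
            have "card (nbr E x0) \<noteq> 0"
              using assms(5) in_vertices_iff[OF assms(1)] subcubic_bipartite_finite_nbr[OF assms(1), of x0] by simp
            then show ?thesis using pend[of x0] subcubic_bipartite_card_nbr[OF assms(1), of x0] assms(6)
              by (intro exI[of _ x0]) linarith
          qed
          then obtain x2 where x2: "card (nbr E x2) = 2" by blast
          then have "nbr E x2 \<noteq> {}" by auto
          then have "(x2, x2) \<in> set ps" using pair by blast
          moreover have "test 4 x2 x2 es" using x2 len_n by (simp add: test_def)
          ultimately have "search 4 ps es \<noteq> None" using search_None by blast
          then obtain x y where xy: "search 4 ps es = Some (x, y)"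
            by (metis option.exhaust surj_pair)
          then have x: "card (nbr E x) = 2" using search_Some[OF xy] len_n by (simp add: test_def)
          then have ne: "nbr E x \<noteq> {}" by auto
          obtain es1 out1 where st1: "sel x (es, out) = (es1, out1)" by force
          have rep1: "represents es1 (select x E)" and len1: "length out1 = Suc (length out)"
            using represents_sel[OF assms(2) ne, of out] st1 by auto
          have scb1: "subcubic_bipartite (select x E)" using assms(1) select_subset by (rule subcubic_bipartite_subset)
          have step: "step ps (es, out) = finish ps (es1, out1)"
            using none0 none1 none2 none3 xy st1 by (simp add: step_def)
          have set_n1: "set (nbrs z es1) = nbr (select x E) z" for z
            using rep1 set_nbrs[of z es1] by (simp add: represents_def)
          show ?thesis
          proof (cases "search 1 ps es1")
            case none: None
            have "inj_on (nbr (select x E)) (\<Union>(select x E))"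
            proof (rule inj_onI, rule ccontr)
              fix u v
              assume uv: "u \<in> \<Union>(select x E)" "v \<in> \<Union>(select x E)" "nbr (select x E) u = nbr (select x E) v" "u \<noteq> v"
              have "u \<in> W" "v \<in> W" using uv(1,2) select_subset[of x E] assms(3) by blast+
              then have "(u, v) \<in> set ps" using assms(4) by blast
              then have "\<not> test 1 u v es1" using search_None[OF none] by blast
              moreover have "nbrs u es1 \<noteq> []"
                using uv(1) in_vertices_iff[OF scb1] set_n1[of u] by auto
              ultimately show False using uv(3,4) set_n1[of u] set_n1[of v] by (auto simp: test_def)
            qed
            then show ?thesis
              using pays_sel[OF assms(2) ne potential_twin_free[OF assms(1) anti x], of out] step none st1
              by (simp add: finish_def)
          next
            case (Some uv)
            then obtain u v where uv: "search 1 ps es1 = Some (u, v)" by force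
            then have t: "u \<noteq> v" "nbr (select x E) u = nbr (select x E) v" "nbr (select x E) u \<noteq> {}"
              using search_Some[OF uv] set_n1[of u] set_n1[of v] by (auto simp: test_def split: if_splits)
            have apart_x: "nbr E x \<inter> nbr E p = {}" if "p \<noteq> x" "card (nbr E p) = 2" for p
              using apart[OF that(1) x that(2)] .
            obtain c d b1 b2 where "nbr (select x E) u = {b1, b2}" "b1 \<noteq> b2"
              using twins_after_select[OF assms(1) anti x apart_x t] by metis
            then have "length (nbrs u es1) = 2" using length_nbrs[OF rep1, of u] by simp
            then obtain e1 e2 where e: "nbrs u es1 = [e1, e2]"
              by (auto simp: numeral_2_eq_2 length_Suc_conv)
            then have e_set: "nbr (select x E) u = {e1, e2}" using set_n1[of u] by simp
            define E2 where "E2 = delete {v} (select x E)"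
            have pot: "potential E \<le> potential (select e2 (select e1 E2)) + 27"
              and ne1: "nbr E2 e1 \<noteq> {}" and ne2: "nbr (select e1 E2) e2 \<noteq> {}"
              using potential_twins[OF assms(1) anti x apart_x t(1,2) e_set] by (auto simp: E2_def)
            have rep2: "represents (del v es1) E2" unfolding E2_def using rep1 by (rule represents_del)
            obtain es3 out3 where st3: "sel e1 (del v es1, out1) = (es3, out3)" by force
            have rep3: "represents es3 (select e1 E2)" and len3: "length out3 = Suc (length out1)"
              using represents_sel[OF rep2 ne1, of out1] st3 by auto
            have fin: "finish ps (es1, out1) = sel e2 (es3, out3)"
              using uv e st3 by (simp add: finish_def hd0_def del: sel.simps)
            have "select e2 (select e1 E2) \<subset> E"
              using select_psubset[OF ne2] select_subset[of e1 E2] delete_subset[of "{v}" "select x E"]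
                select_subset[of x E] unfolding E2_def by blast
            then show ?thesis
              using represents_sel[OF rep3 ne2, of out3] len1 len3 pot
              unfolding pays_def step fin by (intro exI[of _ "select e2 (select e1 E2)"]) simp
          qed
        qed
      qed
    qed
  qed
qed

lemma step_Nil: "step ps ([], out) = ([], out)"
  by (simp add: step_def search_Nil)

lemma iter_Nil: "iter ps fuel ([], out) = ([], out)"
  by (induction fuel) (auto simp: step_Nil)

text \<open>The assumption on subgraphs excludes that the procedure gets stuck; the final graph is empty and
  has potential \<open>0\<close>, so the initial potential has been paid completely.\<close>

lemma iter_potential:
  assumes "subcubic_bipartite E" "represents es E" "\<Union>E \<subseteq> W" "set ps = W \<times> W"
    and "\<And>E'. E' \<subseteq> E \<Longrightarrow> E' \<noteq> {} \<Longrightarrow> \<exists>x \<in> \<Union>E'. card (nbr E' x) \<noteq> 3"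
    and "length es \<le> length fuel"
  shows "potential E + 9 * length out \<le> 9 * length (snd (iter ps fuel (es, out)))"
  using assms
proof (induction fuel arbitrary: E es out)
  case Nil
  then have "E = {}" by (simp add: represents_def edge_set_def)
  then show ?case by (simp add: potential_def nu_ur_empty nbhds_def)
next
  case (Cons f fuel)
  show ?case
  proof (cases "E = {}")
    case True
    then have "es = []" using Cons.prems(2) by (simp add: represents_def edge_set_def)
    then show ?thesis using True
      by (simp add: iter_Nil step_Nil potential_def nu_ur_empty nbhds_def)
  next
    case False
    then obtain x0 where x0: "x0 \<in> \<Union>E" "card (nbr E x0) \<noteq> 3" using Cons.prems(5)[of E] by blast
    obtain es' out' where st': "step ps (es, out) = (es', out')" by force
    obtain E' where E': "E' \<subset> E" "represents es' E'"
      "potential E + 9 * length out \<le> potential E' + 9 * length out'"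
      using step_pays[OF Cons.prems(1-4) x0, of out] st' by (auto simp: pays_def)
    have "length es' < length es"
      using represents_length_less[OF Cons.prems(2) E'(2) Cons.prems(1) E'(1)] .
    moreover have "subcubic_bipartite E'" using Cons.prems(1) E'(1) subcubic_bipartite_subset by blast
    moreover have "\<Union>E' \<subseteq> W" using Cons.prems(3) E'(1) by blast
    moreover have "\<exists>x \<in> \<Union>D. card (nbr D x) \<noteq> 3" if "D \<subseteq> E'" "D \<noteq> {}" for D
      using Cons.prems(5)[of D] that E'(1) by blast
    ultimately have "potential E' + 9 * length out' \<le> 9 * length (snd (iter ps fuel (es', out')))"
      using Cons.prems(4,6) by (intro Cons.IH[OF _ E'(2)]) auto
    then show ?thesis using E'(3) st' by simp
  qed
qed

lemma set_down: "set (down n) = {..n}"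
  by (induction n) (simp_all add: atMost_Suc)

lemma set_row: "set (row x ys ps) = Pair x ` set ys \<union> set ps"
  by (induction x ys ps rule: row.induct) auto

lemma set_pairs: "set (pairs xs ys) = set xs \<times> set ys"
  by (induction xs ys rule: pairs.induct) (auto simp: set_row)

definition solution :: "nat set set \<Rightarrow> edges \<Rightarrow> bool" where
  "solution E r \<longleftrightarrow> uniquely_restricted E (edge_set r) \<and> distinct (map edge r)"

lemma sound_solution:
  assumes "subcubic_bipartite E" "sound E st" shows "solution E (snd st)"
proof -
  obtain E' where E': "E' \<subseteq> E" "lifts E (edge_set (snd st)) E'" "distinct (map edge (snd st))"
    using assms(2) by (auto simp: sound_def)
  then show ?thesis
    using uniquely_restricted_empty[OF subcubic_bipartite_subset[OF assms(1) E'(1)]]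
    unfolding solution_def lifts_def by fastforce
qed

lemma best_solution:
  assumes "subcubic_bipartite E" "represents es E" "solution E cur"
  shows "solution E (best ps es as cur)"
  using assms(3)
proof (induction as arbitrary: cur)
  case (Cons a as)
  have "sound E (es, [])"
    using assms(2) unfolding sound_def lifts_def by (auto simp: edge_set_def)
  then have "solution E (snd (iter ps es (del a es, [])))"
    by (intro sound_solution sound_iter sound_del assms(1))
  then show ?case using Cons by simp
qed simp

lemma best_ge_cur: "length cur \<le> length (best ps es as cur)"
proof (induction as arbitrary: cur)
  case (Cons a as)
  show ?case unfolding best.simps by (rule le_trans[OF _ Cons.IH]) simp
qed simp

lemma best_ge:
  "a \<in> set as \<Longrightarrow> length (snd (iter ps es (del a es, []))) \<le> length (best ps es as cur)"
proof (induction as arbitrary: cur)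
  case (Cons b as)
  show ?case
  proof (cases "a = b")
    case True
    show ?thesis unfolding best.simps by (rule le_trans[OF _ best_ge_cur]) (simp add: True)
  next
    case False
    then show ?thesis using Cons by simp
  qed
qed simp

text \<open>For a cubic graph a vertex \<open>a\<close> is deleted that some optimal matching leaves uncovered. For any
  other graph nothing is deleted, as \<open>z\<close> is not a vertex.\<close>

lemma good_start_vertex:
  assumes "subcubic_bipartite E" "connected_graph V E" "\<Union>E \<subseteq> V" "z \<notin> \<Union>E"
  obtains a where "a \<in> insert z (\<Union>E)" "nu_ur E \<le> nu_ur (delete {a} E)"
    "\<And>E'. E' \<subseteq> delete {a} E \<Longrightarrow> E' \<noteq> {} \<Longrightarrow> \<exists>x \<in> \<Union>E'. card (nbr E' x) \<noteq> 3"
proof (cases "E \<noteq> {} \<and> (\<forall>x \<in> \<Union>E. card (nbr E x) = 3)")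
  case True
  then have "E \<noteq> {}" "\<And>x. x \<in> \<Union>E \<Longrightarrow> card (nbr E x) \<ge> 2" by fastforce+
  then obtain a where a: "a \<in> \<Union>E" "nu_ur E \<le> nu_ur (delete {a} E)"
    using exists_vertex_nu_ur_delete[OF assms(1)] by blast
  have "\<exists>x \<in> \<Union>E'. card (nbr E' x) \<noteq> 3" if "E' \<subseteq> delete {a} E" "E' \<noteq> {}" for E'
  proof (rule ccontr)
    assume "\<not> ?thesis"
    then have "E' = E"
      using cubic_subgraph_of_connected[OF assms(1-3), of E'] that delete_subset[of "{a}" E] by blast
    then show False using that(1) a(1) by (auto simp: delete_def)
  qed
  then show ?thesis using that[of a] a by blast
next
  case False
  have same: "delete {z} E = E" using assms(4) by (auto simp: delete_def)
  have "\<exists>x \<in> \<Union>E'. card (nbr E' x) \<noteq> 3" if "E' \<subseteq> E" "E' \<noteq> {}" for E'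
  proof (rule ccontr)
    assume n: "\<not> ?thesis"
    then have "E' = E" using cubic_subgraph_of_connected[OF assms(1-3), of E'] that by blast
    then show False using n that False by blast
  qed
  then show ?thesis using that[of z] same by simp
qed

theorem approximate_matching_correct:
  assumes "subcubic_bipartite E" "represents es E" "connected_graph {..<n} E" "\<Union>E \<subseteq> {..<n}"
  shows "solution E (approximate_matching n es)"
    and "5 * nu_ur E \<le> 9 * length (approximate_matching n es)"
proof -
  have "solution E []"
    using uniquely_restricted_empty[OF assms(1)] by (simp add: solution_def edge_set_def)
  then show "solution E (approximate_matching n es)"
    unfolding approximate_matching_def by (intro best_solution[OF assms(1,2)])
  have "n \<notin> \<Union>E" using assms(4) by blast
  then obtain a where a: "a \<in> insert n (\<Union>E)" "nu_ur E \<le> nu_ur (delete {a} E)"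
    "\<And>E'. E' \<subseteq> delete {a} E \<Longrightarrow> E' \<noteq> {} \<Longrightarrow> \<exists>x \<in> \<Union>E'. card (nbr E' x) \<noteq> 3"
    using good_start_vertex[OF assms(1,3,4)] by metis
  have "a \<le> n" using a(1) assms(4) by auto
  define ps where "ps = pairs (down n) (down n)"
  have ps: "set ps = {..n} \<times> {..n}" by (simp add: ps_def set_pairs set_down)
  have scb': "subcubic_bipartite (delete {a} E)" using assms(1) delete_subset by (rule subcubic_bipartite_subset)
  have "\<Union>(delete {a} E) \<subseteq> {..n}" using delete_subset[of "{a}" E] assms(4) by fastforce
  then have "potential (delete {a} E) + 9 * length ([] :: edges)
      \<le> 9 * length (snd (iter ps es (del a es, [])))"
    using ps a(3) length_del[of a es]
    by (intro iter_potential[OF scb' represents_del[OF assms(2)]]) auto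
  also have "\<dots> \<le> 9 * length (approximate_matching n es)"
    using best_ge[of a "down n" ps es "[]"] \<open>a \<le> n\<close>
    by (simp add: approximate_matching_def ps_def set_down)
  finally show "5 * nu_ur E \<le> 9 * length (approximate_matching n es)"
    using a(2) twice_nu_ur_le[OF scb'] by (simp add: potential_def)
qed

section \<open>The program\<close>

abbreviation (input) "car e \<equiv> Op1 Car e"
abbreviation (input) "cdr e \<equiv> Op1 Cdr e"
abbreviation (input) "is_dot e \<equiv> Op1 IsDot e"
abbreviation (input) "kons a b \<equiv> Op2 Kons a b"

text \<open>Names for the positions of the functions in the program. As opaque constants they are
  matched literally when the specification of a called function is applied.\<close>

definition fn_eq :: nat where "fn_eq = 1"
definition fn_mem :: nat where "fn_mem = 2"
definition fn_subset :: nat where "fn_subset = 3"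
definition fn_meets :: nat where "fn_meets = 4"
definition fn_nbrs :: nat where "fn_nbrs = 5"
definition fn_del :: nat where "fn_del = 6"
definition fn_dels :: nat where "fn_dels = 7"
definition fn_len :: nat where "fn_len = 8"
definition fn_test :: nat where "fn_test = 9"
definition fn_search :: nat where "fn_search = 10"
definition fn_sel :: nat where "fn_sel = 11"
definition fn_finish :: nat where "fn_finish = 12"
definition fn_step :: nat where "fn_step = 13"
definition fn_iter :: nat where "fn_iter = 14"
definition fn_best :: nat where "fn_best = 15"
definition fn_down :: nat where "fn_down = 16"
definition fn_row :: nat where "fn_row = 17"
definition fn_pairs :: nat where "fn_pairs = 18"

lemmas fn_defs = fn_eq_def fn_mem_def fn_subset_def fn_meets_def fn_nbrs_def fn_del_def fn_dels_def
  fn_len_def fn_test_def fn_search_def fn_sel_def fn_finish_def fn_step_def fn_iter_def fn_best_def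
  fn_down_def fn_row_def fn_pairs_def

abbreviation (input) "eq_exp a b \<equiv> Call fn_eq (kons a b)"

text \<open>Several arguments are passed as nested pairs. Two numbers are equal if both truncated
  differences vanish.\<close>

definition body_eq :: exp where
  "body_eq = Cond (Op2 Sub (car (Var 0)) (cdr (Var 0))) (Const 0)
    (Cond (Op2 Sub (cdr (Var 0)) (car (Var 0))) (Const 0) (Const 1))"

definition body_mem :: exp where
  "body_mem = Cond (is_dot (cdr (Var 0)))
    (Cond (eq_exp (car (Var 0)) (car (cdr (Var 0)))) (Const 1)
      (Call fn_mem (kons (car (Var 0)) (cdr (cdr (Var 0))))))
    (Const 0)"

definition body_subset :: exp where
  "body_subset = Cond (is_dot (car (Var 0)))
    (Cond (Call fn_mem (kons (car (car (Var 0))) (cdr (Var 0))))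
      (Call fn_subset (kons (cdr (car (Var 0))) (cdr (Var 0)))) (Const 0))
    (Const 1)"

definition body_meets :: exp where
  "body_meets = Cond (is_dot (car (Var 0)))
    (Cond (Call fn_mem (kons (car (car (Var 0))) (cdr (Var 0)))) (Const 1)
      (Call fn_meets (kons (cdr (car (Var 0))) (cdr (Var 0)))))
    (Const 0)"

definition body_nbrs :: exp where
  "body_nbrs = Cond (is_dot (cdr (Var 0)))
    (Bind (Call fn_nbrs (kons (car (Var 0)) (cdr (cdr (Var 0)))))
      (Cond (eq_exp (car (Var 1)) (car (car (cdr (Var 1)))))
        (kons (cdr (car (cdr (Var 1)))) (Var 0))
        (Cond (eq_exp (car (Var 1)) (cdr (car (cdr (Var 1)))))
          (kons (car (car (cdr (Var 1)))) (Var 0))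
          (Var 0))))
    (Const 0)"

definition body_del :: exp where
  "body_del = Cond (is_dot (cdr (Var 0)))
    (Bind (Call fn_del (kons (car (Var 0)) (cdr (cdr (Var 0)))))
      (Cond (eq_exp (car (Var 1)) (car (car (cdr (Var 1))))) (Var 0)
        (Cond (eq_exp (car (Var 1)) (cdr (car (cdr (Var 1))))) (Var 0)
          (kons (car (cdr (Var 1))) (Var 0)))))
    (Const 0)"

definition body_dels :: exp where
  "body_dels = Cond (is_dot (car (Var 0)))
    (Call fn_dels (kons (cdr (car (Var 0))) (Call fn_del (kons (car (car (Var 0))) (cdr (Var 0))))))
    (cdr (Var 0))"

definition body_len :: exp where
  "body_len = Cond (is_dot (Var 0)) (Op2 Add (Const 1) (Call fn_len (cdr (Var 0)))) (Const 0)"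

text \<open>The argument is \<open>(m . (x . (y . es)))\<close>; \<open>Var 1\<close> and \<open>Var 0\<close> hold the neighbours of \<open>x\<close> and \<open>y\<close>.\<close>

definition body_test :: exp where
  "body_test =
    Bind (Call fn_nbrs (kons (car (cdr (Var 0))) (cdr (cdr (cdr (Var 0))))))
    (Bind (Call fn_nbrs (kons (car (cdr (cdr (Var 1)))) (cdr (cdr (cdr (Var 1))))))
      (Cond (eq_exp (car (Var 2)) (Const pendant_test)) (eq_exp (Call fn_len (Var 1)) (Const 1))
      (Cond (eq_exp (car (Var 2)) (Const degree_two_test)) (eq_exp (Call fn_len (Var 1)) (Const 2))
      (Cond (eq_exp (car (cdr (Var 2))) (car (cdr (cdr (Var 2))))) (Const 0)
      (Cond (eq_exp (car (Var 2)) (Const twin_test))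
        (Cond (is_dot (Var 1))
          (Cond (Call fn_subset (kons (Var 1) (Var 0))) (Call fn_subset (kons (Var 0) (Var 1))) (Const 0))
          (Const 0))
      (Cond (eq_exp (Call fn_len (Var 1)) (Const 2))
        (Cond (eq_exp (car (Var 2)) (Const nested_test))
          (Call fn_subset (kons (Var 1) (Var 0)))
          (Cond (eq_exp (Call fn_len (Var 0)) (Const 2)) (Call fn_meets (kons (Var 1) (Var 0))) (Const 0)))
        (Const 0)))))))"

definition body_search :: exp where
  "body_search = Cond (is_dot (car (cdr (Var 0))))
    (Cond (Call fn_test (kons (car (Var 0)) (kons (car (car (car (cdr (Var 0)))))
        (kons (cdr (car (car (cdr (Var 0))))) (cdr (cdr (Var 0)))))))
      (car (car (cdr (Var 0))))
      (Call fn_search (kons (car (Var 0)) (kons (cdr (car (cdr (Var 0)))) (cdr (cdr (Var 0)))))))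
    (Const 0)"

definition body_sel :: exp where
  "body_sel =
    Bind (Call fn_nbrs (kons (car (Var 0)) (car (cdr (Var 0)))))
    (Cond (is_dot (Var 0))
      (kons (Call fn_dels (kons (Var 0) (car (cdr (Var 1)))))
        (kons (kons (car (Var 1)) (car (Var 0))) (cdr (cdr (Var 1)))))
      (cdr (Var 1)))"

definition body_finish :: exp where
  "body_finish =
    Bind (Call fn_search (kons (Const twin_test) (kons (car (Var 0)) (car (cdr (Var 0))))))
    (Cond (Var 0)
      (Bind (Call fn_nbrs (kons (car (Var 0)) (car (cdr (Var 1)))))
        (Call fn_sel (kons (car (cdr (Var 0)))
          (Call fn_sel (kons (car (Var 0))
            (kons (Call fn_del (kons (cdr (Var 1)) (car (cdr (Var 2))))) (cdr (cdr (Var 2)))))))))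
      (cdr (Var 1)))"

definition body_step :: exp where
  "body_step =
    Bind (Call fn_search (kons (Const pendant_test) (kons (car (Var 0)) (car (cdr (Var 0))))))
    (Cond (Var 0) (Call fn_sel (kons (car (Var 0)) (cdr (Var 1))))
    (Bind (Call fn_search (kons (Const twin_test) (kons (car (Var 1)) (car (cdr (Var 1))))))
    (Cond (Var 0)
      (kons (Call fn_del (kons (cdr (Var 0)) (car (cdr (Var 2))))) (cdr (cdr (Var 2))))
    (Bind (Call fn_search (kons (Const nested_test) (kons (car (Var 2)) (car (cdr (Var 2))))))
    (Cond (Var 0)
      (Call fn_sel (kons (cdr (Var 0)) (Call fn_sel (kons (car (Var 0)) (cdr (Var 3))))))
    (Bind (Call fn_search (kons (Const meeting_test) (kons (car (Var 3)) (car (cdr (Var 3))))))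
    (Cond (Var 0)
      (Call fn_sel (kons (cdr (Var 0)) (Call fn_sel (kons (car (Var 0)) (cdr (Var 4))))))
    (Bind (Call fn_search (kons (Const degree_two_test) (kons (car (Var 4)) (car (cdr (Var 4))))))
    (Cond (Var 0)
      (Call fn_finish (kons (car (Var 5)) (Call fn_sel (kons (car (Var 0)) (cdr (Var 5))))))
      (cdr (Var 5)))))))))))"

definition body_iter :: exp where
  "body_iter = Cond (is_dot (car (Var 0)))
    (Call fn_iter (kons (cdr (car (Var 0))) (kons (car (cdr (Var 0)))
      (Call fn_step (kons (car (cdr (Var 0))) (cdr (cdr (Var 0))))))))
    (cdr (cdr (Var 0)))"

definition body_best :: exp where
  "body_best = Cond (is_dot (car (Var 0)))
    (Bind (cdr (Call fn_iter (kons (car (cdr (Var 0))) (kons (car (cdr (cdr (Var 0))))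
        (kons (Call fn_del (kons (car (car (Var 0))) (car (cdr (Var 0))))) (Const 0))))))
      (Call fn_best (kons (cdr (car (Var 1))) (kons (car (cdr (Var 1))) (kons (car (cdr (cdr (Var 1))))
        (Cond (Op2 Sub (Call fn_len (Var 0)) (Call fn_len (cdr (cdr (cdr (Var 1))))))
          (Var 0) (cdr (cdr (cdr (Var 1))))))))))
    (cdr (cdr (cdr (Var 0))))"

definition body_down :: exp where
  "body_down = Cond (Var 0) (kons (Var 0) (Call fn_down (Op2 Sub (Var 0) (Const 1))))
    (kons (Const 0) (Const 0))"

definition body_row :: exp where
  "body_row = Cond (is_dot (car (cdr (Var 0))))
    (kons (kons (car (Var 0)) (car (car (cdr (Var 0)))))
      (Call fn_row (kons (car (Var 0)) (kons (cdr (car (cdr (Var 0)))) (cdr (cdr (Var 0)))))))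
    (cdr (cdr (Var 0)))"

definition body_pairs :: exp where
  "body_pairs = Cond (is_dot (car (Var 0)))
    (Call fn_row (kons (car (car (Var 0))) (kons (cdr (Var 0))
      (Call fn_pairs (kons (cdr (car (Var 0))) (cdr (Var 0)))))))
    (Const 0)"

definition body_main :: exp where
  "body_main = Bind (Call fn_down (car (Var 0)))
    (Call fn_best (kons (Var 0) (kons (cdr (Var 1))
      (kons (Call fn_pairs (kons (Var 0) (Var 0))) (Const 0)))))"

definition prog :: program where
  "prog = [body_main, body_eq, body_mem, body_subset, body_meets, body_nbrs, body_del, body_dels,
    body_len, body_test, body_search, body_sel, body_finish, body_step, body_iter, body_best,
    body_down, body_row, body_pairs]"

lemma fn_less_length:
  "fn_eq < length prog" "fn_mem < length prog" "fn_subset < length prog" "fn_meets < length prog"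
  "fn_nbrs < length prog" "fn_del < length prog" "fn_dels < length prog" "fn_len < length prog"
  "fn_test < length prog" "fn_search < length prog" "fn_sel < length prog" "fn_finish < length prog"
  "fn_step < length prog" "fn_iter < length prog" "fn_best < length prog" "fn_down < length prog"
  "fn_row < length prog" "fn_pairs < length prog"
  by (simp_all add: prog_def fn_defs)

lemma prog_nth:
  "prog ! fn_eq = body_eq" "prog ! fn_mem = body_mem" "prog ! fn_subset = body_subset"
  "prog ! fn_meets = body_meets" "prog ! fn_nbrs = body_nbrs" "prog ! fn_del = body_del"
  "prog ! fn_dels = body_dels" "prog ! fn_len = body_len" "prog ! fn_test = body_test"
  "prog ! fn_search = body_search" "prog ! fn_sel = body_sel" "prog ! fn_finish = body_finish"
  "prog ! fn_step = body_step" "prog ! fn_iter = body_iter" "prog ! fn_best = body_best"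
  "prog ! fn_down = body_down" "prog ! fn_row = body_row" "prog ! fn_pairs = body_pairs"
  "prog ! 0 = body_main"
  by (simp_all add: prog_def fn_defs)

section \<open>Correctness and running time of the program\<close>

text \<open>The weakest precondition of an expression for a property of its value and its number of steps.
  The equations below let the simplifier execute an expression symbolically until it reaches a call,
  where \<open>wp_callI\<close> continues with the specification of the called function.\<close>

definition wp :: "val list \<Rightarrow> exp \<Rightarrow> (val \<Rightarrow> nat \<Rightarrow> bool) \<Rightarrow> bool" where
  "wp env e Q \<longleftrightarrow> (\<exists>v t. eval prog env e v t \<and> Q v t)"

definition wp_call :: "nat \<Rightarrow> val \<Rightarrow> (val \<Rightarrow> nat \<Rightarrow> bool) \<Rightarrow> bool" where
  "wp_call f v Q \<longleftrightarrow> wp [v] (prog ! f) Q"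

text \<open>Specifications of functions only bound the number of steps from above.\<close>

definition computes :: "nat \<Rightarrow> val \<Rightarrow> val \<Rightarrow> nat \<Rightarrow> bool" where
  "computes f v w T \<longleftrightarrow> (\<exists>t \<le> T. eval prog [v] (prog ! f) w t)"

lemmas eval_intros = eval.intros[unfolded Suc_eq_plus1[symmetric], unfolded One_nat_def]

lemma wp_Var: "i < length env \<Longrightarrow> wp env (Var i) Q \<longleftrightarrow> Q (env ! i) (Suc 0)"
  unfolding wp_def by (auto elim: eval_cases intro: eval_intros)

lemma wp_Const: "wp env (Const k) Q \<longleftrightarrow> Q (Atom k) (Suc 0)"
  unfolding wp_def by (auto elim: eval_cases intro: eval_intros)

lemma wp_Op1: "wp env (Op1 f e) Q \<longleftrightarrow> wp env e (\<lambda>v t. Q (apply1 f v) (Suc t))"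
  unfolding wp_def by (blast elim: eval_cases intro: eval_intros)

lemma wp_Op2: "wp env (Op2 f a b) Q \<longleftrightarrow>
    wp env a (\<lambda>v t. wp env b (\<lambda>w s. Q (apply2 f v w) (Suc (t + s))))"
  unfolding wp_def by (blast elim: eval_cases intro: eval_intros)

lemma wp_Cond: "wp env (Cond c a b) Q \<longleftrightarrow>
    wp env c (\<lambda>v t. (v \<noteq> Atom 0 \<longrightarrow> wp env a (\<lambda>w s. Q w (Suc (t + s)))) \<and>
      (v = Atom 0 \<longrightarrow> wp env b (\<lambda>w s. Q w (Suc (t + s)))))"
  unfolding wp_def
proof (intro iffI; elim exE conjE)
  fix v t assume "eval prog env (Cond c a b) v t" "Q v t"
  then show "\<exists>v t. eval prog env c v t \<and>
      (v \<noteq> Atom 0 \<longrightarrow> (\<exists>w s. eval prog env a w s \<and> Q w (Suc (t + s)))) \<and>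
      (v = Atom 0 \<longrightarrow> (\<exists>w s. eval prog env b w s \<and> Q w (Suc (t + s))))"
    by (elim eval_cases) blast+
next
  fix v t assume "eval prog env c v t"
    "v \<noteq> Atom 0 \<longrightarrow> (\<exists>w s. eval prog env a w s \<and> Q w (Suc (t + s)))"
    "v = Atom 0 \<longrightarrow> (\<exists>w s. eval prog env b w s \<and> Q w (Suc (t + s)))"
  then show "\<exists>v t. eval prog env (Cond c a b) v t \<and> Q v t"
    by (cases "v = Atom 0") (blast intro: eval_intros)+
qed

lemma wp_Bind: "wp env (Bind a b) Q \<longleftrightarrow>
    wp env a (\<lambda>v t. wp (v # env) b (\<lambda>w s. Q w (Suc (t + s))))"
  unfolding wp_def by (blast elim: eval_cases intro: eval_intros)

lemma wp_Call: "f < length prog \<Longrightarrow> wp env (Call f e) Q \<longleftrightarrow>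
    wp env e (\<lambda>v t. wp_call f v (\<lambda>w s. Q w (Suc (t + s))))"
  unfolding wp_def wp_call_def by (blast elim: eval_cases intro: eval_intros)

lemmas wp_simps = wp_Var wp_Const wp_Op1 wp_Op2 wp_Cond wp_Bind wp_Call fn_less_length

lemma computesI: "wp [v] (prog ! f) (\<lambda>w' t. w' = w \<and> t \<le> T) \<Longrightarrow> computes f v w T"
  unfolding wp_def computes_def by blast

lemma wp_callI: "computes f v w T \<Longrightarrow> (\<And>t. t \<le> T \<Longrightarrow> Q w t) \<Longrightarrow> wp_call f v Q"
  unfolding computes_def wp_call_def wp_def by blast

text \<open>Opaque to the simplifier, which would otherwise split the remaining computation into cases at
  each truth value.\<close>

definition val_of_bool :: "bool \<Rightarrow> val" where
  "val_of_bool b = Atom (if b then 1 else 0)"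

lemma val_of_bool_simps [simp]:
  "val_of_bool b = Atom 0 \<longleftrightarrow> \<not> b" "Atom 0 = val_of_bool b \<longleftrightarrow> \<not> b"
  "val_of_bool b = Atom (Suc 0) \<longleftrightarrow> b" "Atom (Suc 0) = val_of_bool b \<longleftrightarrow> b"
  "val_of_bool b = val_of_bool c \<longleftrightarrow> b = c"
  by (auto simp: val_of_bool_def)

definition val_of_nats :: "nat list \<Rightarrow> val" where
  "val_of_nats xs = val_of_list (map Atom xs)"

definition val_of_edges :: "edges \<Rightarrow> val" where
  "val_of_edges es = val_of_list (map val_of_pair es)"

lemma val_of_nats_simps [simp]:
  "val_of_nats [] = Atom 0" "val_of_nats (x # xs) = Dot (Atom x) (val_of_nats xs)"
  by (simp_all add: val_of_nats_def)

lemma val_of_edges_simps [simp]: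
  "val_of_edges [] = Atom 0"
  "val_of_edges ((u, v) # es) = Dot (Dot (Atom u) (Atom v)) (val_of_edges es)"
  by (simp_all add: val_of_edges_def val_of_pair_def)

lemma apply1_val_of_nats [simp]:
  "apply1 IsDot (val_of_nats xs) = val_of_bool (xs \<noteq> [])"
  "apply1 Car (val_of_nats xs) = Atom (hd0 xs)"
  "apply1 Cdr (val_of_nats xs) = val_of_nats (tl xs)"
  by (cases xs; simp add: hd0_def val_of_bool_def)+

lemma computes_eq: "computes fn_eq (Dot (Atom x) (Atom y)) (val_of_bool (x = y)) 20"
  by (rule computesI) (auto simp: prog_nth body_eq_def wp_simps)

lemma computes_mem:
  "computes fn_mem (Dot (Atom x) (val_of_nats xs)) (val_of_bool (x \<in> set xs)) (60 * length xs + 20)"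
proof (induction xs arbitrary: x)
  case Nil
  show ?case by (rule computesI) (simp add: prog_nth body_mem_def wp_simps)
next
  case (Cons y ys)
  show ?case
    by (rule computesI)
      (auto simp: prog_nth body_mem_def wp_simps intro!: wp_callI[OF computes_eq] wp_callI[OF Cons.IH])
qed

text \<open>Here and below, nested loops use a bound \<open>K\<close> for the cost of the inner loop, so that all
  inequalities stay linear.\<close>

lemma computes_subset:
  assumes "60 * length ys + 60 \<le> K"
  shows "computes fn_subset (Dot (val_of_nats xs) (val_of_nats ys))
    (val_of_bool (set xs \<subseteq> set ys)) (length xs * K + 20)"
proof (induction xs)
  case Nil
  show ?case by (rule computesI) (simp add: prog_nth body_subset_def wp_simps)
next
  case (Cons x xs)
  show ?case using assms
    by (intro computesI)
      (auto simp: prog_nth body_subset_def wp_simps intro!: wp_callI[OF computes_mem] wp_callI[OF Cons.IH])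
qed

lemma computes_meets:
  assumes "60 * length ys + 60 \<le> K"
  shows "computes fn_meets (Dot (val_of_nats xs) (val_of_nats ys))
    (val_of_bool (set xs \<inter> set ys \<noteq> {})) (length xs * K + 20)"
proof (induction xs)
  case Nil
  show ?case by (rule computesI) (simp add: prog_nth body_meets_def wp_simps)
next
  case (Cons x xs)
  show ?case using assms
    by (intro computesI)
      (auto simp: prog_nth body_meets_def wp_simps intro!: wp_callI[OF computes_mem] wp_callI[OF Cons.IH])
qed

lemma computes_nbrs:
  "computes fn_nbrs (Dot (Atom x) (val_of_edges es)) (val_of_nats (nbrs x es)) (100 * length es + 20)"
proof (induction es arbitrary: x)
  case Nil
  show ?case by (rule computesI) (simp add: prog_nth body_nbrs_def wp_simps)
next
  case (Cons uv es)
  obtain u v where "uv = (u, v)" by force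
  then show ?case
    by (intro computesI)
      (auto simp: prog_nth body_nbrs_def wp_simps intro!: wp_callI[OF computes_eq] wp_callI[OF Cons.IH])
qed

lemma computes_del:
  "computes fn_del (Dot (Atom x) (val_of_edges es)) (val_of_edges (del x es)) (100 * length es + 20)"
proof (induction es arbitrary: x)
  case Nil
  show ?case by (rule computesI) (simp add: prog_nth body_del_def wp_simps)
next
  case (Cons uv es)
  obtain u v where "uv = (u, v)" by force
  then show ?case
    by (intro computesI)
      (auto simp: prog_nth body_del_def wp_simps intro!: wp_callI[OF computes_eq] wp_callI[OF Cons.IH])
qed

lemma computes_dels:
  assumes "100 * length es + 60 \<le> K"
  shows "computes fn_dels (Dot (val_of_nats xs) (val_of_edges es)) (val_of_edges (dels xs es))
    (length xs * K + 20)"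
  using assms
proof (induction xs es rule: dels.induct)
  case (1 es)
  show ?case by (rule computesI) (simp add: prog_nth body_dels_def wp_simps)
next
  case (2 x xs es)
  have IH: "computes fn_dels (Dot (val_of_nats xs) (val_of_edges (del x es)))
      (val_of_edges (dels xs (del x es))) (length xs * K + 20)"
    using 2 length_del[of x es] by simp
  show ?case using 2(2)
    by (intro computesI)
      (auto simp: prog_nth body_dels_def wp_simps intro!: wp_callI[OF computes_del] wp_callI[OF IH])
qed

lemma computes_len_nats:
  "computes fn_len (val_of_nats xs) (Atom (length xs)) (20 * length xs + 20)"
proof (induction xs)
  case Nil
  show ?case by (rule computesI) (simp add: prog_nth body_len_def wp_simps)
next
  case (Cons x xs)
  show ?case
    by (rule computesI) (auto simp: prog_nth body_len_def wp_simps intro!: wp_callI[OF Cons.IH])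
qed

lemma computes_len_edges:
  "computes fn_len (val_of_edges xs) (Atom (length xs)) (20 * length xs + 20)"
proof (induction xs)
  case Nil
  show ?case by (rule computesI) (simp add: prog_nth body_len_def wp_simps)
next
  case (Cons x xs)
  obtain u v where "x = (u, v)" by force
  then show ?case
    by (intro computesI) (auto simp: prog_nth body_len_def wp_simps intro!: wp_callI[OF Cons.IH])
qed

lemma length_nbrs_le: "length (nbrs x es) \<le> length es"
  by (induction x es rule: nbrs.induct) auto


lemma computes_mono: "computes f v w T \<Longrightarrow> T \<le> T' \<Longrightarrow> computes f v w T'"
  unfolding computes_def by (meson le_trans)

text \<open>The cases are chosen such that in each of them all branches are decided.\<close>

lemma computes_test:
  assumes "length es \<le> N"
  shows "computes fn_test (Dot (Atom m) (Dot (Atom x) (Dot (Atom y) (val_of_edges es))))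
    (val_of_bool (test m x y es)) (2 * (N * (60 * N + 60)) + 300 * N + 600)"
proof -
  define K where "K = N * (60 * N + 60)"
  have len: "length (nbrs x es) \<le> N" for x using length_nbrs_le assms by (rule le_trans)
  have K: "length (nbrs x es) * (60 * N + 60) + 20 \<le> K + 20" for x
    unfolding K_def using len[of x] by simp
  have nbrs: "computes fn_nbrs (Dot (Atom x) (val_of_edges es)) (val_of_nats (nbrs x es)) (100 * N + 20)" for x
    by (rule computes_mono[OF computes_nbrs]) (use assms in simp)
  have length: "computes fn_len (val_of_nats (nbrs x es)) (Atom (length (nbrs x es))) (20 * N + 20)" for x
    by (rule computes_mono[OF computes_len_nats]) (use len in simp)
  have subset: "computes fn_subset (Dot (val_of_nats (nbrs x es)) (val_of_nats (nbrs y es)))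
      (val_of_bool (set (nbrs x es) \<subseteq> set (nbrs y es))) (K + 20)" for x y
    by (rule computes_mono[OF computes_subset K]) (use len in simp)
  have meets: "computes fn_meets (Dot (val_of_nats (nbrs x es)) (val_of_nats (nbrs y es)))
      (val_of_bool (set (nbrs x es) \<inter> set (nbrs y es) \<noteq> {})) (K + 20)" for x y
    by (rule computes_mono[OF computes_meets K]) (use len in simp)
  note calls = wp_callI[OF computes_eq] wp_callI[OF nbrs] wp_callI[OF length] wp_callI[OF subset]
    wp_callI[OF meets]
  consider "m = pendant_test"
    | "m \<noteq> pendant_test" "m = degree_two_test"
    | "m \<noteq> pendant_test" "m \<noteq> degree_two_test" "x = y"
    | "m = twin_test" "x \<noteq> y" "nbrs x es = []"
    | "m = twin_test" "x \<noteq> y" "nbrs x es \<noteq> []" "set (nbrs x es) \<subseteq> set (nbrs y es)"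
    | "m = twin_test" "x \<noteq> y" "nbrs x es \<noteq> []" "\<not> set (nbrs x es) \<subseteq> set (nbrs y es)"
    | "m \<noteq> pendant_test" "m \<noteq> degree_two_test" "m \<noteq> Suc 0" "x \<noteq> y" "length (nbrs x es) \<noteq> 2"
    | "m = nested_test" "x \<noteq> y" "length (nbrs x es) = 2"
    | "m \<noteq> pendant_test" "m \<noteq> degree_two_test" "m \<noteq> Suc 0" "m \<noteq> nested_test" "x \<noteq> y" "length (nbrs x es) = 2" "length (nbrs y es) \<noteq> 2"
    | "m \<noteq> pendant_test" "m \<noteq> degree_two_test" "m \<noteq> Suc 0" "m \<noteq> nested_test" "x \<noteq> y" "length (nbrs x es) = 2" "length (nbrs y es) = 2"
    by auto
  then have "computes fn_test (Dot (Atom m) (Dot (Atom x) (Dot (Atom y) (val_of_edges es))))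
    (val_of_bool (test m x y es)) (2 * K + 300 * N + 600)"
  proof cases
    case 1
    note [simp] = 1
    have t: "test m x y es \<longleftrightarrow> length (nbrs x es) = 1" by (simp add: test_def)
    show ?thesis unfolding t
      by (rule computesI, simp add: prog_nth body_test_def wp_simps, ((rule calls), simp?)+)
  next
    case 2
    note [simp] = 2
    have t: "test m x y es \<longleftrightarrow> length (nbrs x es) = 2" by (simp add: test_def)
    show ?thesis unfolding t
      by (rule computesI, simp add: prog_nth body_test_def wp_simps, ((rule calls), simp?)+)
  next
    case 3
    note [simp] = 3
    have t: "test m x y es \<longleftrightarrow> False" by (simp add: test_def)
    show ?thesis unfolding t
      by (rule computesI, simp add: prog_nth body_test_def wp_simps, ((rule calls), simp?)+)
  next
    case 4
    note [simp] = 4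
    have t: "test m x y es \<longleftrightarrow> False" by (simp add: test_def)
    show ?thesis unfolding t
      by (rule computesI, simp add: prog_nth body_test_def wp_simps, ((rule calls), simp?)+)
  next
    case 5
    note [simp] = 5
    have t: "test m x y es \<longleftrightarrow> set (nbrs y es) \<subseteq> set (nbrs x es)" by (simp add: test_def)
    show ?thesis unfolding t
      by (rule computesI, simp add: prog_nth body_test_def wp_simps, ((rule calls), simp?)+)
  next
    case 6
    note [simp] = 6
    have t: "test m x y es \<longleftrightarrow> False" by (simp add: test_def)
    show ?thesis unfolding t
      by (rule computesI, simp add: prog_nth body_test_def wp_simps, ((rule calls), simp?)+)
  next
    case 7
    note [simp] = 7
    have t: "test m x y es \<longleftrightarrow> False" by (simp add: test_def)
    show ?thesis unfolding t
      by (rule computesI, simp add: prog_nth body_test_def wp_simps, ((rule calls), simp?)+)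
  next
    case 8
    note [simp] = 8
    have t: "test m x y es \<longleftrightarrow> set (nbrs x es) \<subseteq> set (nbrs y es)" by (simp add: test_def)
    show ?thesis unfolding t
      by (rule computesI, simp add: prog_nth body_test_def wp_simps, ((rule calls), simp?)+)
  next
    case 9
    note [simp] = 9
    have t: "test m x y es \<longleftrightarrow> False" by (simp add: test_def)
    show ?thesis unfolding t
      by (rule computesI, simp add: prog_nth body_test_def wp_simps, ((rule calls), simp?)+)
  next
    case 10
    note [simp] = 10
    have t: "test m x y es \<longleftrightarrow> set (nbrs x es) \<inter> set (nbrs y es) \<noteq> {}" by (simp add: test_def)
    show ?thesis unfolding t
      by (rule computesI, simp add: prog_nth body_test_def wp_simps, ((rule calls), simp?)+)
  qed
  then show ?thesis by (simp add: K_def)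
qed

definition val_of_option :: "(nat \<times> nat) option \<Rightarrow> val" where
  "val_of_option r = (case r of None \<Rightarrow> Atom 0 | Some p \<Rightarrow> val_of_pair p)"

lemma val_of_option_simps [simp]:
  "val_of_option None = Atom 0" "val_of_option (Some (x, y)) = Dot (Atom x) (Atom y)"
  by (simp_all add: val_of_option_def val_of_pair_def)

lemma computes_search:
  assumes "\<And>x y. computes fn_test (Dot (Atom m) (Dot (Atom x) (Dot (Atom y) (val_of_edges es))))
    (val_of_bool (test m x y es)) T"
  shows "computes fn_search (Dot (Atom m) (Dot (val_of_edges ps) (val_of_edges es)))
    (val_of_option (search m ps es)) (length ps * (T + 60) + 20)"
proof (induction ps)
  case Nil
  show ?case by (rule computesI) (simp add: prog_nth body_search_def wp_simps)
next
  case (Cons p ps)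
  obtain x y where "p = (x, y)" by force
  then show ?case
    by (intro computesI)
      (auto simp: prog_nth body_search_def wp_simps intro!: wp_callI[OF assms] wp_callI[OF Cons.IH])
qed

definition val_of_state :: "edges \<times> edges \<Rightarrow> val" where
  "val_of_state st = Dot (val_of_edges (fst st)) (val_of_edges (snd st))"

lemma apply1_val_of_state [simp]:
  "apply1 Car (val_of_state st) = val_of_edges (fst st)"
  "apply1 Cdr (val_of_state st) = val_of_edges (snd st)"
  by (simp_all add: val_of_state_def)

lemma computes_sel_Dot:
  assumes "length es \<le> N"
  shows "computes fn_sel (Dot (Atom x) (Dot (val_of_edges es) (val_of_edges out)))
    (val_of_state (sel x (es, out))) (N * (100 * N + 60) + 100 * N + 100)"
proof -
  define K where "K = N * (100 * N + 60)"
  have len: "length (nbrs x es) \<le> N" using length_nbrs_le assms by (rule le_trans)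
  have K: "length (nbrs x es) * (100 * N + 60) + 20 \<le> K + 20"
    unfolding K_def using len by simp
  have nbrs: "computes fn_nbrs (Dot (Atom x) (val_of_edges es)) (val_of_nats (nbrs x es)) (100 * N + 20)"
    by (rule computes_mono[OF computes_nbrs]) (use assms in simp)
  have dels: "computes fn_dels (Dot (val_of_nats (nbrs x es)) (val_of_edges es))
      (val_of_edges (dels (nbrs x es) es)) (K + 20)"
    by (rule computes_mono[OF computes_dels K]) (use assms in simp)
  have "computes fn_sel (Dot (Atom x) (Dot (val_of_edges es) (val_of_edges out)))
    (val_of_state (sel x (es, out))) (K + 100 * N + 100)"
    by (rule computesI)
      (auto simp: prog_nth body_sel_def wp_simps val_of_state_def hd0_def split: list.split
        intro!: wp_callI[OF nbrs] wp_callI[OF dels])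
  then show ?thesis by (simp add: K_def)
qed

lemma length_sel: "length (fst (sel x st)) \<le> length (fst st)" "length (snd (sel x st)) \<le> Suc (length (snd st))"
  by (cases st; simp add: length_dels del: dels.simps split: list.split)+

lemma length_finish:
  "length (fst (finish ps st)) \<le> length (fst st)"
  "length (snd (finish ps st)) \<le> 2 + length (snd st)"
proof -
  have "length (fst (sel a (sel b (del v (fst st), snd st)))) \<le> length (fst st)" for a b v
    using length_sel(1)[of a "sel b (del v (fst st), snd st)"] length_sel(1)[of b "(del v (fst st), snd st)"]
      length_del[of v "fst st"] by simp
  moreover have "length (snd (sel a (sel b (del v (fst st), snd st)))) \<le> 2 + length (snd st)" for a b v
    using length_sel(2)[of a "sel b (del v (fst st), snd st)"] length_sel(2)[of b "(del v (fst st), snd st)"]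
    by simp
  ultimately show "length (fst (finish ps st)) \<le> length (fst st)"
    "length (snd (finish ps st)) \<le> 2 + length (snd st)"
    by (simp_all add: finish_def del: sel.simps split: option.split)
qed

lemma length_step:
  "length (fst (step ps st)) \<le> length (fst st)"
  "length (snd (step ps st)) \<le> 3 + length (snd st)"
proof -
  have one: "length (fst (sel x st)) \<le> length (fst st)" "length (snd (sel x st)) \<le> 3 + length (snd st)" for x
    using length_sel[of x st] by simp_all
  have two: "length (fst (sel y (sel x st))) \<le> length (fst st)"
    "length (snd (sel y (sel x st))) \<le> 3 + length (snd st)" for x y
    using length_sel[of y "sel x st"] length_sel[of x st] by simp_all
  have three: "length (fst (finish ps (sel x st))) \<le> length (fst st)"
    "length (snd (finish ps (sel x st))) \<le> 3 + length (snd st)" for x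
    using length_finish[of ps "sel x st"] length_sel[of x st] by simp_all
  show "length (fst (step ps st)) \<le> length (fst st)" "length (snd (step ps st)) \<le> 3 + length (snd st)"
    by (simp_all add: step_def one two three length_del del: sel.simps split: option.split)
qed

lemma length_iter: "length (snd (iter ps fuel st)) \<le> 3 * length fuel + length (snd st)"
proof (induction ps fuel st rule: iter.induct)
  case (2 ps f fuel st)
  then show ?case using length_step(2)[of ps st] by simp
qed simp

lemma computes_finish:
  assumes search: "\<And>m es. length es \<le> N \<Longrightarrow>
      computes fn_search (Dot (Atom m) (Dot (val_of_edges ps) (val_of_edges es)))
        (val_of_option (search m ps es)) A"
    and sel: "\<And>x es out. length es \<le> N \<Longrightarrow>
      computes fn_sel (Dot (Atom x) (Dot (val_of_edges es) (val_of_edges out))) (val_of_state (sel x (es, out))) B"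
    and "length (fst st) \<le> N"
  shows "computes fn_finish (Dot (val_of_edges ps) (val_of_state st)) (val_of_state (finish ps st))
    (A + 2 * B + 200 * N + 200)"
proof -
  have sel': "computes fn_sel (Dot (Atom x) (val_of_state st)) (val_of_state (sel x st)) B"
    if "length (fst st) \<le> N" for x st
    using sel[OF that, of x "snd st"] by (simp add: val_of_state_def)
  have nbrs: "computes fn_nbrs (Dot (Atom x) (val_of_edges (fst st))) (val_of_nats (nbrs x (fst st))) (100 * N + 20)" for x
    by (rule computes_mono[OF computes_nbrs]) (use assms in simp)
  have del: "computes fn_del (Dot (Atom x) (val_of_edges (fst st))) (val_of_edges (del x (fst st))) (100 * N + 20)" for x
    by (rule computes_mono[OF computes_del]) (use assms in simp)
  have len_del: "length (del x (fst st)) \<le> N" for x using length_del assms(3) by (rule le_trans)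
  have len_sel: "length (fst (sel y (del x (fst st), snd st))) \<le> N" for x y
    using length_sel(1)[of y "(del x (fst st), snd st)"] len_del[of x] by (simp del: sel.simps)
  show ?thesis
  proof (cases "search twin_test ps (fst st)")
    case None
    then show ?thesis
      by (intro computesI)
        (auto simp: prog_nth body_finish_def wp_simps finish_def val_of_state_def
          intro!: wp_callI[OF search] assms(3))
  next
    case (Some uv)
    then obtain u v where uv: "search twin_test ps (fst st) = Some (u, v)" by force
    show ?thesis
      by (rule computesI)
        (auto simp: prog_nth body_finish_def wp_simps finish_def uv[simplified] simp del: sel.simps
          intro!: wp_callI[OF search] wp_callI[OF nbrs] wp_callI[OF del]
            wp_callI[OF sel] wp_callI[OF sel'] assms(3) len_del len_sel)
  qed
qed

lemma computes_step:
  assumes search: "\<And>m es. length es \<le> N \<Longrightarrow>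
      computes fn_search (Dot (Atom m) (Dot (val_of_edges ps) (val_of_edges es)))
        (val_of_option (search m ps es)) A"
    and sel: "\<And>x es out. length es \<le> N \<Longrightarrow>
      computes fn_sel (Dot (Atom x) (Dot (val_of_edges es) (val_of_edges out))) (val_of_state (sel x (es, out))) B"
    and len: "length (fst st) \<le> N"
  shows "computes fn_step (Dot (val_of_edges ps) (val_of_state st)) (val_of_state (step ps st))
    (6 * A + 5 * B + 400 * N + 600)"
proof -
  have sel': "computes fn_sel (Dot (Atom x) (val_of_state st)) (val_of_state (sel x st)) B"
    if "length (fst st) \<le> N" for x st
    using sel[OF that, of x "snd st"] by (simp add: val_of_state_def)
  have fin: "computes fn_finish (Dot (val_of_edges ps) (val_of_state (sel x st)))
      (val_of_state (finish ps (sel x st))) (A + 2 * B + 200 * N + 200)" for x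
    using length_sel(1)[of x st] len by (intro computes_finish[OF search sel]) auto
  have del: "computes fn_del (Dot (Atom x) (val_of_edges (fst st))) (val_of_edges (del x (fst st))) (100 * N + 20)" for x
    by (rule computes_mono[OF computes_del]) (use len in simp)
  have len_sel: "length (fst (sel x st)) \<le> N" for x using length_sel(1) len by (rule le_trans)
  have state: "val_of_state st = Dot (val_of_edges (fst st)) (val_of_edges (snd st))"
    by (rule val_of_state_def)
  have sel_st: "computes fn_sel (Dot (Atom x) (Dot (val_of_edges (fst st)) (val_of_edges (snd st))))
      (val_of_state (sel x st)) B" for x
    using sel'[OF len, of x] by (simp add: state)
  show ?thesis
    unfolding state
    by (rule computesI)
      (auto simp: prog_nth body_step_def wp_simps step_def val_of_state_def[of "(_, _)"] simp del: sel.simps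
        split: option.split
        intro!: wp_callI[OF search] wp_callI[OF del] wp_callI[OF sel_st] wp_callI[OF sel']
          wp_callI[OF fin] len len_sel state[symmetric])
qed


lemma computes_iter:
  assumes step: "\<And>st. length (fst st) \<le> N \<Longrightarrow>
      computes fn_step (Dot (val_of_edges ps) (val_of_state st)) (val_of_state (step ps st)) S"
    and "length (fst st) \<le> N"
  shows "computes fn_iter (Dot (val_of_edges fuel) (Dot (val_of_edges ps) (val_of_state st)))
    (val_of_state (iter ps fuel st)) (length fuel * (S + 60) + 20)"
  using assms(2)
proof (induction fuel arbitrary: st)
  case Nil
  show ?case by (rule computesI) (simp add: prog_nth body_iter_def wp_simps)
next
  case (Cons e fuel)
  obtain u v where "e = (u, v)" by force
  have len: "length (fst (step ps st)) \<le> N" using length_step(1) Cons.prems by (rule le_trans)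
  show ?case
    by (rule computesI)
      (auto simp: prog_nth body_iter_def wp_simps \<open>e = (u, v)\<close>
        intro!: wp_callI[OF step] wp_callI[OF Cons.IH] Cons.prems len)
qed

lemma computes_best:
  assumes iter: "\<And>a. computes fn_iter
      (Dot (val_of_edges es) (Dot (val_of_edges ps) (Dot (val_of_edges (del a es)) (Atom 0))))
      (val_of_state (iter ps es (del a es, []))) T"
    and "length es \<le> N" "length cur \<le> 3 * N"
  shows "computes fn_best (Dot (val_of_nats as) (Dot (val_of_edges es) (Dot (val_of_edges ps) (val_of_edges cur))))
    (val_of_edges (best ps es as cur)) (length as * (T + 300 * N + 200) + 20)"
  using assms(3)
proof (induction as arbitrary: cur)
  case Nil
  show ?case by (rule computesI) (simp add: prog_nth body_best_def wp_simps)
next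
  case (Cons a as)
  have del: "computes fn_del (Dot (Atom x) (val_of_edges es)) (val_of_edges (del x es)) (100 * N + 20)" for x
    by (rule computes_mono[OF computes_del]) (use assms in simp)
  define r where "r = snd (iter ps es (del a es, []))"
  have r: "length r \<le> 3 * N"
    using length_iter[of ps es "(del a es, [])"] assms(2) by (simp add: r_def)
  have len: "computes fn_len (val_of_edges xs) (Atom (length xs)) (60 * N + 20)" if "length xs \<le> 3 * N" for xs
    by (rule computes_mono[OF computes_len_edges]) (use that in simp)
  show ?case
  proof (cases "length cur < length r")
    case True
    then show ?thesis
      by (intro computesI)
        (auto simp: prog_nth body_best_def wp_simps r_def[symmetric]
          intro!: wp_callI[OF del] wp_callI[OF iter] wp_callI[OF len] wp_callI[OF Cons.IH] r Cons.prems)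
  next
    case False
    then show ?thesis
      by (intro computesI)
        (auto simp: prog_nth body_best_def wp_simps r_def[symmetric]
          intro!: wp_callI[OF del] wp_callI[OF iter] wp_callI[OF len] wp_callI[OF Cons.IH] r Cons.prems)
  qed
qed

lemma computes_down: "computes fn_down (Atom n) (val_of_nats (down n)) (40 * n + 20)"
proof (induction n)
  case 0
  show ?case by (rule computesI) (simp add: prog_nth body_down_def wp_simps)
next
  case (Suc n)
  show ?case
    by (rule computesI) (auto simp: prog_nth body_down_def wp_simps intro!: wp_callI[OF Suc.IH])
qed

lemma computes_row:
  "computes fn_row (Dot (Atom x) (Dot (val_of_nats ys) (val_of_edges ps)))
    (val_of_edges (row x ys ps)) (60 * length ys + 20)"
proof (induction ys)
  case Nil
  show ?case by (rule computesI) (simp add: prog_nth body_row_def wp_simps)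
next
  case (Cons y ys)
  show ?case
    by (rule computesI)
      (auto simp: prog_nth body_row_def wp_simps hd0_def intro!: wp_callI[OF Cons.IH])
qed

lemma computes_pairs:
  "computes fn_pairs (Dot (val_of_nats xs) (val_of_nats ys))
    (val_of_edges (pairs xs ys)) (length xs * (60 * length ys + 100) + 20)"
proof (induction xs)
  case Nil
  show ?case by (rule computesI) (simp add: prog_nth body_pairs_def wp_simps)
next
  case (Cons x xs)
  show ?case
    by (rule computesI)
      (auto simp: prog_nth body_pairs_def wp_simps hd0_def intro!: wp_callI[OF computes_row] wp_callI[OF Cons.IH])
qed

lemma length_down: "length (down n) = Suc n"
  by (induction n) simp_all

lemma length_row: "length (row x ys ps) = length ys + length ps"
  by (induction x ys ps rule: row.induct) simp_all

lemma length_pairs: "length (pairs xs ys) = length xs * length ys"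
  by (induction xs ys rule: pairs.induct) (simp_all add: length_row)

text \<open>The bounds are kept as explicit polynomial expressions in the number \<open>n\<close> of vertices and a bound
  \<open>N\<close> on the number of edges. There are \<open>Suc n * Suc n\<close> pairs to be searched.\<close>

definition search_time :: "nat \<Rightarrow> nat \<Rightarrow> nat" where
  "search_time n N = Suc n * Suc n * (2 * (N * (60 * N + 60)) + 300 * N + 600 + 60) + 20"

definition step_time :: "nat \<Rightarrow> nat \<Rightarrow> nat" where
  "step_time n N = 6 * search_time n N + 5 * (N * (100 * N + 60) + 100 * N + 100) + 400 * N + 600"

definition best_time :: "nat \<Rightarrow> nat \<Rightarrow> nat" where
  "best_time n N = Suc n * ((N * (step_time n N + 60) + 20) + 300 * N + 200) + 20"

definition main_time :: "nat \<Rightarrow> nat \<Rightarrow> nat" where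
  "main_time n N = best_time n N + Suc n * (60 * Suc n + 100) + 40 * n + 100"

lemma computes_main:
  assumes "length es \<le> N"
  shows "computes 0 (Dot (Atom n) (val_of_edges es)) (val_of_edges (approximate_matching n es)) (main_time n N)"
proof -
  define ps where "ps = pairs (down n) (down n)"
  have len_ps: "length ps = Suc n * Suc n" by (simp add: ps_def length_pairs length_down)
  have search: "computes fn_search (Dot (Atom m) (Dot (val_of_edges ps) (val_of_edges es)))
        (val_of_option (search m ps es)) (search_time n N)" if "length es \<le> N" for m es
    using computes_search[OF computes_test[OF that], of m ps] by (simp only: len_ps search_time_def)
  have step: "computes fn_step (Dot (val_of_edges ps) (val_of_state st)) (val_of_state (step ps st)) (step_time n N)"
    if "length (fst st) \<le> N" for st
    unfolding step_time_def by (rule computes_step[OF search computes_sel_Dot that])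
  have iter: "computes fn_iter
      (Dot (val_of_edges es) (Dot (val_of_edges ps) (Dot (val_of_edges (del a es)) (Atom 0))))
      (val_of_state (iter ps es (del a es, []))) (N * (step_time n N + 60) + 20)" for a
  proof (rule computes_mono)
    have "length (del a es) \<le> N" using length_del assms by (rule le_trans)
    then show "computes fn_iter
      (Dot (val_of_edges es) (Dot (val_of_edges ps) (Dot (val_of_edges (del a es)) (Atom 0))))
      (val_of_state (iter ps es (del a es, []))) (length es * (step_time n N + 60) + 20)"
      using computes_iter[OF step, where st = "(del a es, [])" and fuel = es] by (simp add: val_of_state_def)
  qed (use assms in simp)
  have best: "computes fn_best (Dot (val_of_nats (down n)) (Dot (val_of_edges es) (Dot (val_of_edges ps) (Atom 0))))
    (val_of_edges (approximate_matching n es)) (best_time n N)"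
    using computes_best[OF iter assms, of "[]" "down n"]
    by (simp add: approximate_matching_def best_time_def ps_def length_down)
  have pairs: "computes fn_pairs (Dot (val_of_nats (down n)) (val_of_nats (down n))) (val_of_edges ps)
      (Suc n * (60 * Suc n + 100) + 20)"
    using computes_pairs[of "down n" "down n"] by (simp only: length_down ps_def)
  define A where "A = Suc n * (60 * Suc n + 100)"
  show ?thesis
    unfolding main_time_def A_def[symmetric]
    by (rule computesI)
      (auto simp: prog_nth body_main_def wp_simps
        intro!: wp_callI[OF computes_down] wp_callI[OF pairs[folded A_def]] wp_callI[OF best])
qed


section \<open>The approximation theorem\<close>

lemma subcubic_bipartiteI:
  fixes E :: "nat set set"
  assumes "simple_graph {..<n} E" "subcubic {..<n} E" "bipartite {..<n} E"
  shows "subcubic_bipartite E"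
proof -
  have V: "e \<subseteq> {..<n}" if "e \<in> E" for e using assms(1) that by (simp add: simple_graph_def)
  then have fin: "finite E" by (intro finite_subset[of E "Pow {..<n}"]) auto
  moreover have "\<exists>A. \<forall>e\<in>E. \<exists>a\<in>A. \<exists>b. b \<notin> A \<and> e = {a, b}"
    using assms(3) unfolding bipartite_def by (meson disjoint_iff)
  moreover have "card (nbr E x) \<le> 3" for x
  proof (cases "x < n")
    case True
    have "card (nbr E x) \<le> card {e \<in> E. x \<in> e}"
    proof (rule card_inj_on_le)
      show "inj_on (\<lambda>y. {x, y}) (nbr E x)" by (auto simp: inj_on_def doubleton_eq_iff)
    qed (use fin in \<open>auto simp: nbr_def\<close>)
    then show ?thesis using assms(2) True by (force simp: subcubic_def degree_of_def)
  next
    case False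
    then have "nbr E x = {}" using V by (fastforce simp: nbr_def)
    then show ?thesis by simp
  qed
  ultimately show ?thesis by (simp add: subcubic_bipartite_def)
qed

lemma card_edges_subcubic:
  fixes E :: "nat set set"
  assumes "simple_graph {..<n} E" "subcubic {..<n} E"
  shows "card E \<le> 3 * n"
proof -
  have "finite E"
    using assms(1) by (intro finite_subset[of E "Pow {..<n}"]) (auto simp: simple_graph_def)
  have "E \<subseteq> (\<Union>v\<in>{..<n}. {e \<in> E. v \<in> e})"
  proof
    fix e assume e: "e \<in> E"
    then have "e \<subseteq> {..<n}" "e \<noteq> {}" using assms(1) by (auto simp: simple_graph_def)
    then show "e \<in> (\<Union>v\<in>{..<n}. {e \<in> E. v \<in> e})" using e by blast
  qed
  then have "card E \<le> card (\<Union>v\<in>{..<n}. {e \<in> E. v \<in> e})"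
    using \<open>finite E\<close> by (intro card_mono) auto
  also have "\<dots> \<le> (\<Sum>v\<in>{..<n}. card {e \<in> E. v \<in> e})" by (rule card_UN_le) simp
  also have "\<dots> \<le> (\<Sum>v\<in>{..<n}. 3)"
    using assms(2) by (intro sum_mono) (simp add: subcubic_def degree_of_def)
  finally show ?thesis by simp
qed

lemma main_time_poly: "\<exists>p. \<forall>n. poly p n = main_time n (3 * n) + 2"
proof -
  define N :: "nat poly" where "N = [:0, 3:]"
  define S :: "nat poly" where "S = [:1, 1:]"
  define search where "search = S * S * (2 * (N * (60 * N + 60)) + 300 * N + 600 + 60) + 20"
  define step where "step = 6 * search + 5 * (N * (100 * N + 60) + 100 * N + 100) + 400 * N + 600"
  define best where "best = S * ((N * (step + 60) + 20) + 300 * N + 200) + 20"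
  define p where "p = best + S * (60 * S + 100) + [:0, 40:] + 100 + 2"
  have "poly p n = main_time n (3 * n) + 2" for n
  proof -
    have NS: "poly N n = 3 * n" "poly S n = Suc n" by (simp_all add: N_def S_def)
    have "poly search n = search_time n (3 * n)"
      by (simp only: search_def search_time_def poly_add poly_mult poly_numeral NS)
    then have "poly step n = step_time n (3 * n)"
      by (simp only: step_def step_time_def poly_add poly_mult poly_numeral NS)
    then have "poly best n = best_time n (3 * n)"
      by (simp only: best_def best_time_def poly_add poly_mult poly_numeral NS)
    then show ?thesis
      by (simp only: p_def main_time_def poly_add poly_mult poly_numeral NS) simp
  qed
  then show ?thesis by blast
qed

theorem theorem2:
  "\<exists>(P :: program) (p :: nat poly). \<forall>(n :: nat) (E :: nat set set) (x :: val).
     simple_graph {..<n} E \<longrightarrow> connected_graph {..<n} E \<longrightarrow> subcubic {..<n} E \<longrightarrow>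
     bipartite {..<n} E \<longrightarrow> encodes_graph n E x \<longrightarrow>
     (\<exists>y t M. runs P x y t \<and> t \<le> poly p n \<and> encodes_edges M y \<and>
        uniquely_restricted E M \<and> real (card M) \<ge> 5 / 9 * real (nu_ur E))"
proof -
  obtain p where p: "\<And>n. poly p n = main_time n (3 * n) + 2" using main_time_poly by blast
  show ?thesis
  proof (intro exI[of _ prog] exI[of _ p] allI impI)
    fix n :: nat and E :: "nat set set" and x :: val
    assume g: "simple_graph {..<n} E" "connected_graph {..<n} E" "subcubic {..<n} E"
      "bipartite {..<n} E" "encodes_graph n E x"
    have scb: "subcubic_bipartite E" using g(1,3,4) by (rule subcubic_bipartiteI)
    obtain es where es: "x = Dot (Atom n) (val_of_edges es)" "represents es E"
      using g(5) by (auto simp: encodes_graph_def encodes_edges_def val_of_edges_def represents_def edge_set_def)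
    define r where "r = approximate_matching n es"
    have "\<Union>E \<subseteq> {..<n}" using g(1) by (auto simp: simple_graph_def)
    then have sol: "solution E r" and size: "5 * nu_ur E \<le> 9 * length r"
      using approximate_matching_correct[OF scb es(2) g(2)] by (simp_all add: r_def)
    have "length es \<le> 3 * n"
      using card_edges_subcubic[OF g(1,3)] represents_length[OF es(2)] by simp
    then obtain t where t: "eval prog [x] (prog ! 0) (val_of_edges r) t" "t \<le> main_time n (3 * n)"
      using computes_main[of es "3 * n" n] by (auto simp: computes_def es(1) r_def)
    have "eval prog [x] (Call 0 (Var 0)) (val_of_edges r) (1 + t + 1)"
      using eval.Call[OF eval.Var[of 0 "[x]" prog] _ , of 0] t(1) by (simp add: prog_def)
    then have "runs prog x (val_of_edges r) (t + 2)" by (simp add: runs_def)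
    moreover have "t + 2 \<le> poly p n" using t(2) p by simp
    moreover have "encodes_edges (edge_set r) (val_of_edges r)"
      using sol unfolding encodes_edges_def val_of_edges_def solution_def edge_set_def by blast
    moreover have "uniquely_restricted E (edge_set r)" using sol by (simp add: solution_def)
    moreover have "card (edge_set r) = length r"
      using sol distinct_card by (fastforce simp: solution_def edge_set_def)
    then have "real (card (edge_set r)) \<ge> 5 / 9 * real (nu_ur E)" using size by simp
    ultimately show "\<exists>y t M. runs prog x y t \<and> t \<le> poly p n \<and> encodes_edges M y \<and>
        uniquely_restricted E M \<and> real (card M) \<ge> 5 / 9 * real (nu_ur E)" by blast
  qed
qed

end
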